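(* For every $c\in(0,1)$, $$\Delta^{(c)}=1+\frac{\beta^{(c)}}{\log 2},$$ where $\Delta^{(c)}$ is the Gelfond exponent of the weighted $(c)$-Thue-Morse sequence and $\beta^{(c)}=\sup_{\mu\in \mathrm{Inv}(f)}\int \log|\cos\pi(x+c)|\,d\mu(x)$ is the ergodic supremum of the potential $x\mapsto\log|\cos\pi(x+c)|$ for the doubling map $f$ on the circle.
   Context: For $n\in\mathbb{N}$ (including $n=0$) let $s(n)$ be the sum of the binary digits of $n$. For $c\in[0,1)$ the weighted $(c)$-Thue-Morse sequence is $t^{(c)}(n):=e^{2\pi i c\, s(n)}$. The sequence $t^{(c)}$ is said to be of Gelfond type if there is a constant $\alpha^{(c)}\in(1/2,1)$ such that $$\max_{0\le t\le 1}\left|\sum_{n=0}^{N-1}t^{(c)}(n)e^{2\pi i n t}\right|=O\big(N^{\alpha^{(c)}}\big)\qquad (N\to\infty).$$ The smallest such $\alpha^{(c)}$ is called the Gelfond exponent and is denoted $\Delta^{(c)}$. Let $\mathcal{S}=\mathbb{R}/\mathbb{Z}$ be the one-dimensional torus, $f:\mathcal{S}\to\mathcal{S}$, $f(x)=2x \pmod 1$, the doubling map, and $\mathrm{Inv}(f)$ the set of $f$-invariant Borel probability measures on $\mathcal{S}$. The function $g^{(c)}(x):=\log|\cos\pi(x+c)|$ on $\mathcal{S}$ is upper semi-continuous, with the convention $\log 0=-\infty$. The ergodic supremum is $\beta^{(c)}:=\sup_{\mu\in\mathrm{Inv}(f)}\int g^{(c)}\,d\mu$. *)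

theory Defs
  imports "HOL-Probability.Probability" "HOL-Library.Landau_Symbols"
begin

text \<open>The digit at position \<open>k\<close> is \<open>n div 2 ^ k mod 2\<close>; since \<open>n < 2 ^ n\<close>, the positions
  \<open>k < n\<close> cover all non-zero digits.\<close>

definition binary_digit_sum :: "nat \<Rightarrow> nat" where
  "binary_digit_sum n = (\<Sum>k<n. n div 2 ^ k mod 2)"

definition thue_morse :: "real \<Rightarrow> nat \<Rightarrow> complex" where
  "thue_morse c n = cis (2 * pi * c * real (binary_digit_sum n))"

text \<open>The supremum below is a maximum: the function of \<open>t\<close> is continuous on a compact interval.\<close>

definition thue_morse_sup_norm :: "real \<Rightarrow> nat \<Rightarrow> real" where
  "thue_morse_sup_norm c N =
     (SUP t\<in>{0..1}. cmod (\<Sum>n<N. thue_morse c n * cis (2 * pi * real n * t)))"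

definition gelfond_bound :: "real \<Rightarrow> real \<Rightarrow> bool" where
  "gelfond_bound c \<alpha> \<longleftrightarrow>
     1 / 2 < \<alpha> \<and> \<alpha> < 1 \<and> (\<lambda>N. thue_morse_sup_norm c N) \<in> O(\<lambda>N. real N powr \<alpha>)"

text \<open>The smallest \<open>\<alpha>\<close>, that is, an attained minimum and not merely an infimum; it is unique if
  it exists.\<close>

definition is_gelfond_exponent :: "real \<Rightarrow> real \<Rightarrow> bool" where
  "is_gelfond_exponent c \<Delta> \<longleftrightarrow> gelfond_bound c \<Delta> \<and> (\<forall>\<alpha>. gelfond_bound c \<alpha> \<longrightarrow> \<Delta> \<le> \<alpha>)"

definition cong_mod_one :: "real \<Rightarrow> real \<Rightarrow> bool" where
  "cong_mod_one x y \<longleftrightarrow> x - y \<in> \<int>"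

lemma equivp_cong_mod_one: "equivp cong_mod_one"
proof (rule equivpI)
  show "reflp cong_mod_one"
    by (simp add: reflp_def cong_mod_one_def)
  show "symp cong_mod_one"
    unfolding symp_def cong_mod_one_def using Ints_minus by fastforce
  show "transp cong_mod_one"
    unfolding transp_def cong_mod_one_def using Ints_add by fastforce
qed

quotient_type torus = real / cong_mod_one
  by (rule equivp_cong_mod_one)

text \<open>The quotient topology; it determines the Borel sigma-algebra \<open>borel :: torus measure\<close>.\<close>

instantiation torus :: topological_space
begin

definition open_torus :: "torus set \<Rightarrow> bool" where
  "open_torus U \<longleftrightarrow> open (abs_torus -` U)"

instance
  by standard (auto simp: open_torus_def vimage_Union)

end

lift_definition doubling :: "torus \<Rightarrow> torus" is "\<lambda>x. 2 * x"
proof -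
  fix x y :: real
  assume "cong_mod_one x y"
  then have "2 * (x - y) \<in> \<int>"
    unfolding cong_mod_one_def by (rule Ints_mult [OF Ints_numeral])
  then show "cong_mod_one (2 * x) (2 * y)"
    by (simp only: cong_mod_one_def right_diff_distrib)
qed

lemma abs_cos_pi_cong:
  assumes "cong_mod_one x y"
  shows "\<bar>cos (pi * (x + c))\<bar> = \<bar>cos (pi * (y + c))\<bar>"
proof -
  obtain k where "x - y = of_int k"
    using assms unfolding cong_mod_one_def by (auto elim: Ints_cases)
  then have x: "x = y + of_int k"
    by simp
  have "pi * (x + c) = pi * (y + c) + pi * of_int k"
    unfolding x by (simp only: distrib_left add.commute add.left_commute)
  moreover have "\<bar>cos (pi * of_int k)\<bar> = 1"
    by simp
  ultimately show ?thesis
    by (simp only: cos_add sin_npi_int mult_zero_right diff_0_right abs_mult mult_1_right)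
qed

text \<open>The library has \<open>ln 0 = 0\<close> on the reals, so the convention \<open>log 0 = -\<infinity>\<close> is built in here.\<close>

lift_definition potential :: "real \<Rightarrow> torus \<Rightarrow> ereal" is
  "\<lambda>c x. if cos (pi * (x + c)) = 0 then - \<infinity> else ereal (ln \<bar>cos (pi * (x + c))\<bar>)"
proof -
  fix c x y :: real
  assume "cong_mod_one x y"
  then have "\<bar>cos (pi * (x + c))\<bar> = \<bar>cos (pi * (y + c))\<bar>"
    by (rule abs_cos_pi_cong)
  then show "(if cos (pi * (x + c)) = 0 then - \<infinity> else ereal (ln \<bar>cos (pi * (x + c))\<bar>)) =
      (if cos (pi * (y + c)) = 0 then - \<infinity> else ereal (ln \<bar>cos (pi * (y + c))\<bar>))"
    by (cases "cos (pi * (x + c)) = 0") auto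
qed

text \<open>Integral of an extended-real function as the integral of its positive part minus that of its
  negative part; \<open>e2ennreal\<close> maps negative numbers to \<open>0\<close>.\<close>

definition ereal_integral :: "'a measure \<Rightarrow> ('a \<Rightarrow> ereal) \<Rightarrow> ereal" where
  "ereal_integral M h =
     enn2ereal (\<integral>\<^sup>+x. e2ennreal (h x) \<partial>M) - enn2ereal (\<integral>\<^sup>+x. e2ennreal (- h x) \<partial>M)"

definition invariant_measures :: "torus measure set" where
  "invariant_measures =
     {\<mu>. prob_space \<mu> \<and> sets \<mu> = sets borel \<and> distr \<mu> borel doubling = \<mu>}"

definition ergodic_supremum :: "real \<Rightarrow> ereal" where
  "ergodic_supremum c = (SUP \<mu>\<in>invariant_measures. ereal_integral \<mu> (potential c))"

end

(* With P_n(x) = \<Prod>k<n |cos pi(2^k x + c)|, the exponential sum of length 2^n has modulus 2^n P_n(t),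
   and N is a sum of distinct powers of 2, so the theorem says that M_n = max P_n lies between
   exp(n beta) and C exp(n beta). The lower bound is immediate: integrating log P_n gives
   n * integral of g <= log M_n for every invariant measure. For the upper bound, a Bernstein
   inequality keeps P_n comparable to M_n within 2^-n / 4 of a maximum. Two points of period n + 2
   lie there, about 2^-n / 4 apart, and since c is not an integer, P_2(w) and P_2(w + 1/4) have no
   common zero. Hence P_(n+2) is at least a constant times M_n at one of these two points, and the
   uniform measure on its orbit gives (n + 2) beta >= log M_n - const. *)

theory Submission
  imports Defs "HOL-Library.Real_Mod"
begin

section \<open>Digit sums and the product formula\<close>

text \<open>The exponent must be an attained minimum inside the open interval (1/2, 1). An upper
  bound exp(n (beta + eps)) for M_n would only give an infimum, so the loss has to be a constant.
  The obstacle is that the potential takes the value -infinity: its values along nearby orbits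
  cannot be compared factor by factor. The whole product, however, is the modulus of a trigonometric
  polynomial, and Bernstein control near its maximum does not see the zeros of single factors. The
  Bernstein bound is positive for |y - x0| < 2^-n / sqrt 12. Points of period n or n + 1 are too
  sparse to guarantee two of them in this window; from period n + 2 on (n large) both neighbours of
  x0 lie in it. The price is two additional factors, which may vanish at one of the neighbours;
  hence the choice between two. Finally, -log 2 / 2 < beta < 0 has to be shown to place the exponent
  strictly between 1/2 and 1.\<close>

lemma binary_digit_sum_eq:
  assumes "n < 2 ^ K"
  shows "binary_digit_sum n = (\<Sum>k<K. n div 2 ^ k mod 2)"
proof -
  have "(\<Sum>k<a. n div 2 ^ k mod 2) = (\<Sum>k<b. n div 2 ^ k mod 2)" if "n < 2 ^ a" "a \<le> b" for a b
  proof (rule sum.mono_neutral_left)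
    show "\<forall>i\<in>{..<b} - {..<a}. n div 2 ^ i mod 2 = 0"
    proof
      fix i assume "i \<in> {..<b} - {..<a}"
      then have "(2::nat) ^ a \<le> 2 ^ i" by (intro power_increasing) auto
      with \<open>n < 2 ^ a\<close> have "n < 2 ^ i" by linarith
      then show "n div 2 ^ i mod 2 = 0" by simp
    qed
  qed (use that in auto)
  moreover have "n < 2 ^ n" by (rule less_exp)
  ultimately show ?thesis
    unfolding binary_digit_sum_def using assms by (metis linear)
qed

lemma binary_digit_sum_add_power:
  assumes "m < 2 ^ k"
  shows "binary_digit_sum (2 ^ k + m) = Suc (binary_digit_sum m)"
proof -
  have "(2 ^ k + m) div 2 ^ i mod 2 = m div 2 ^ i mod 2" if "i < k" for i
  proof -
    obtain j where "k = Suc i + j" using \<open>i < k\<close> less_iff_Suc_add by auto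
    then have "(2::nat) ^ k + m = m + 2 ^ i * (2 * 2 ^ j)" by (simp add: power_add)
    then have "(2 ^ k + m) div 2 ^ i = m div 2 ^ i + 2 * 2 ^ j" by simp
    then show ?thesis by simp
  qed
  moreover have "(2 ^ k + m) div 2 ^ k mod 2 = 1" using assms by simp
  moreover have "2 ^ k + m < 2 ^ Suc k" using assms by simp
  ultimately have "binary_digit_sum (2 ^ k + m) = (\<Sum>i<k. m div 2 ^ i mod 2) + 1"
    by (simp add: binary_digit_sum_eq[of _ "Suc k"])
  then show ?thesis using binary_digit_sum_eq[OF assms] by simp
qed

definition thue_morse_sum :: "real \<Rightarrow> nat \<Rightarrow> real \<Rightarrow> complex" where
  "thue_morse_sum c N t = (\<Sum>n<N. thue_morse c n * cis (2 * pi * real n * t))"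

text \<open>A new leading bit raises the digit sum by one and the frequency by \<open>2 ^ k\<close>,
  so the second block is a copy of the first up to a single phase. The case \<open>N = 2 ^ k\<close>
  drives the product formula, smaller \<open>N\<close> the dyadic decomposition.\<close>

lemma thue_morse_sum_add_power:
  assumes "N \<le> 2 ^ k"
  shows "thue_morse_sum c (2 ^ k + N) t =
    thue_morse_sum c (2 ^ k) t + cis (2 * pi * (2 ^ k * t + c)) * thue_morse_sum c N t"
  using assms
proof (induction N)
  case 0
  then show ?case by (simp add: thue_morse_sum_def)
next
  case (Suc N)
  have "thue_morse c (2 ^ k + N) * cis (2 * pi * real (2 ^ k + N) * t) =
      cis (2 * pi * (2 ^ k * t + c)) * (thue_morse c N * cis (2 * pi * real N * t))"
    using Suc.prems binary_digit_sum_add_power[of N k]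
    by (simp add: thue_morse_def cis_mult) (simp add: algebra_simps)
  with Suc show ?case by (simp add: thue_morse_sum_def distrib_left)
qed

text \<open>The exponential of a Birkhoff sum of \<open>potential c\<close>. In product form the
  value -infinity becomes an ordinary zero.\<close>

definition cos_prod :: "real \<Rightarrow> nat \<Rightarrow> real \<Rightarrow> real" where
  "cos_prod c n x = (\<Prod>k<n. \<bar>cos (pi * (2 ^ k * x + c))\<bar>)"

lemma norm_one_plus_cis: "cmod (1 + cis (2 * x)) = 2 * \<bar>cos x\<bar>"
proof -
  have "1 + cis (2 * x) = of_real (2 * cos x) * cis x"
    by (rule complex_eqI) (simp_all add: cos_double_cos sin_double power2_eq_square)
  then show ?thesis by (simp add: norm_mult)
qed

lemma norm_thue_morse_sum_power2: "cmod (thue_morse_sum c (2 ^ n) t) = 2 ^ n * cos_prod c n t"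
proof (induction n)
  case 0
  then show ?case by (simp add: thue_morse_sum_def thue_morse_def cos_prod_def)
next
  case (Suc n)
  have "(2::nat) ^ Suc n = 2 ^ n + 2 ^ n" by simp
  then have "thue_morse_sum c (2 ^ Suc n) t =
      (1 + cis (2 * (pi * (2 ^ n * t + c)))) * thue_morse_sum c (2 ^ n) t"
    using thue_morse_sum_add_power[of "2 ^ n" n c t]
    by (simp only: distrib_right mult_1_left mult.assoc order_refl)
  then show ?case
    by (simp add: norm_mult norm_one_plus_cis Suc cos_prod_def)
qed

lemma cos_prod_nonneg [simp]: "0 \<le> cos_prod c n x"
  by (simp add: cos_prod_def prod_nonneg)

lemma cos_prod_le_1 [simp]: "cos_prod c n x \<le> 1"
  by (simp add: cos_prod_def prod_le_1)

lemma continuous_on_cos_prod [continuous_intros]: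
  "continuous_on A (cos_prod c n)"
  unfolding cos_prod_def by (intro continuous_intros)

lemma cos_prod_add: "cos_prod c (n + m) x = cos_prod c n x * cos_prod c m (2 ^ n * x)"
  by (induction m) (simp_all add: cos_prod_def power_add mult_ac)

lemma cos_prod_cong:
  assumes "cong_mod_one x y"
  shows "cos_prod c n x = cos_prod c n y"
  unfolding cos_prod_def
proof (rule prod.cong)
  fix k
  have "2 ^ k * (x - y) \<in> \<int>" using assms unfolding cong_mod_one_def by (intro Ints_mult) auto
  then have "cong_mod_one (2 ^ k * x) (2 ^ k * y)"
    by (simp add: cong_mod_one_def right_diff_distrib)
  then show "\<bar>cos (pi * (2 ^ k * x + c))\<bar> = \<bar>cos (pi * (2 ^ k * y + c))\<bar>"
    by (rule abs_cos_pi_cong)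
qed simp

lemma cong_mod_one_frac: "cong_mod_one x (frac x)"
  by (simp add: cong_mod_one_def frac_def)

section \<open>A Bernstein inequality near the maximum\<close>

text \<open>Jordan's inequality: sine is concave on this interval and lies above its chord;
  \<open>2 / pi * x\<close> is the weight of the endpoint \<open>pi / 2\<close>.\<close>

lemma sin_ge_Jordan:
  fixes x :: real
  assumes "0 \<le> x" "x \<le> pi / 2"
  shows "2 / pi * x \<le> sin x"
proof -
  have "convex_on {0..pi/2} (\<lambda>x. - sin x)"
  proof (rule f''_ge0_imp_convex)
    fix x :: real assume "x \<in> {0..pi/2}"
    then show "0 \<le> sin x" by (intro sin_ge_zero) auto
  next
    fix x :: real
    show "((\<lambda>x. - sin x) has_real_derivative - cos x) (at x)"
      "((\<lambda>x. - cos x) has_real_derivative sin x) (at x)"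
      by (auto intro!: derivative_eq_intros)
  qed auto
  from convex_onD[OF this, of "2 / pi * x" 0 "pi / 2"] assms
  show ?thesis by (simp add: field_simps)
qed

section \<open>Discrete Fourier transform of a centred parabola\<close>

lemma sum_by_parts_power:
  fixes p :: "nat \<Rightarrow> 'a::comm_ring_1"
  shows "(w - 1) * (\<Sum>m<N. p m * w ^ m) = p N * w ^ N - p 0 - w * (\<Sum>m<N. (p (Suc m) - p m) * w ^ m)"
  by (induction N) (simp_all add: algebra_simps)

text \<open>Two Abel summations. The centre (N - 1) / 2 makes the values of the parabola at 0 and
  \<open>N\<close> differ by \<open>N\<close> only, instead of \<open>N^2\<close>; the boundary term
  is then harmless and the coefficient is of order N / |w - 1|^2.\<close>

lemma sum_centred_squares_root_unity:
  fixes w :: complex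
  assumes "w ^ N = 1" "w \<noteq> 1"
  shows "(w - 1)\<^sup>2 * (\<Sum>m<N. of_real ((real m - (real N - 1) / 2)\<^sup>2) * w ^ m) = - of_nat N * (1 + w)"
proof -
  define S where "S = (\<Sum>m<N. of_real ((real m - (real N - 1) / 2)\<^sup>2) * w ^ m)"
  define S1 where "S1 = (\<Sum>m<N. of_nat m * w ^ m)"
  have S0: "(\<Sum>m<N. w ^ m) = 0"
    using geometric_sum[OF assms(2), of N] assms by simp
  have S1: "(w - 1) * S1 = of_nat N"
    using sum_by_parts_power[of w "of_nat" N] S0 assms by (simp add: S1_def)
  have diff: "of_real ((real (Suc m) - (real N - 1) / 2)\<^sup>2) - of_real ((real m - (real N - 1) / 2)\<^sup>2) =
      2 * of_nat m + (2 - of_nat N :: complex)" for m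
  proof -
    have "(real (Suc m) - (real N - 1) / 2)\<^sup>2 - (real m - (real N - 1) / 2)\<^sup>2 = 2 * real m + (2 - real N)"
      by (simp add: power2_eq_square field_simps)
    then have "complex_of_real ((real (Suc m) - (real N - 1) / 2)\<^sup>2 - (real m - (real N - 1) / 2)\<^sup>2) =
        of_real (2 * real m + (2 - real N))"
      by (rule arg_cong)
    then show ?thesis by (simp only: of_real_diff of_real_add of_real_mult of_real_of_nat_eq of_real_numeral)
  qed
  have "(\<Sum>m<N. (2 * of_nat m + (2 - of_nat N)) * w ^ m) = 2 * S1 + (2 - of_nat N) * (\<Sum>m<N. w ^ m)"
    by (simp add: S1_def sum.distrib sum_subtractf sum_distrib_left ring_distribs mult_ac)
  then have "(w - 1) * S = of_real ((real N - (real N - 1) / 2)\<^sup>2) - of_real (((real N - 1) / 2)\<^sup>2) - w * (2 * S1)"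
    using sum_by_parts_power[of w "\<lambda>m. of_real ((real m - (real N - 1) / 2)\<^sup>2)" N] assms
    unfolding diff S_def S0 by simp
  also have "\<dots> = of_nat N - 2 * w * S1"
    by (simp add: power2_eq_square field_simps)
  finally have "(w - 1)\<^sup>2 * S = (w - 1) * (of_nat N - 2 * w * S1)"
    by (simp only: power2_eq_square mult.assoc)
  also have "\<dots> = (w - 1) * of_nat N - 2 * w * ((w - 1) * S1)"
    by (simp add: algebra_simps)
  finally have "(w - 1)\<^sup>2 * S = (w - 1) * of_nat N - 2 * w * ((w - 1) * S1)" .
  then show ?thesis unfolding S1 S_def by (simp add: algebra_simps)
qed

lemma sum_centred_squares_le:
  "(\<Sum>m<N. (real m - (real N - 1) / 2)\<^sup>2) \<le> real N ^ 3 / 12"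
proof -
  \<comment> \<open>The centre depends on \<open>N\<close>, so the induction runs with a free centre
    \<open>s\<close>.\<close>
  have sum: "6 * (\<Sum>m<n. (real m - s)\<^sup>2) =
      real n * (real n - 1) * (2 * real n - 1) - 6 * s * real n * (real n - 1) + 6 * s\<^sup>2 * real n" for s n
    by (induction n) (simp_all add: power2_eq_square algebra_simps)
  have "12 * (\<Sum>m<N. (real m - (real N - 1) / 2)\<^sup>2) = real N ^ 3 - real N"
    using sum[where s = "(real N - 1) / 2" and n = N]
    by (simp add: power2_eq_square power3_eq_cube algebra_simps)
  then show ?thesis by simp
qed

lemma sum_inverse_squares_le: "(\<Sum>k=1..n. 1 / (real k)\<^sup>2) \<le> 2"
proof -
  \<comment> \<open>The strengthening by 1 / n lets the induction telescope.\<close>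
  have "(\<Sum>k=1..n. 1 / (real k)\<^sup>2) \<le> 2 - 1 / real n" if "n \<ge> 1"
    using that
  proof (induction n rule: dec_induct)
    case base
    then show ?case by simp
  next
    case (step n)
    have "1 / (real (Suc n))\<^sup>2 \<le> 1 / (real n * real (Suc n))"
      using step by (intro divide_left_mono) (auto simp: power2_eq_square)
    also have "\<dots> = 1 / real n - 1 / real (Suc n)"
      using step by (simp add: field_simps)
    finally show ?case using step by simp
  qed
  moreover have "0 \<le> 1 / real n" by simp
  ultimately show ?thesis
    by (cases "n = 0") (auto intro: order_trans)
qed

lemma sum_cis_orthogonal:
  assumes "m < N" "l < N"
  shows "(\<Sum>k<N. cis (2 * pi * (real m - real l) * real k / real N)) = (if m = l then of_nat N else 0)"
proof (cases "m = l")
  case False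
  define w where "w = cis (2 * pi * (real m - real l) / real N)"
  have pow: "w ^ k = cis (2 * pi * (real m - real l) * real k / real N)" for k
    by (simp add: w_def Complex.DeMoivre mult_ac)
  have "w ^ N = cis (2 * pi * (of_int (int m) - of_int (int l)))"
    using assms by (simp add: pow)
  also have "\<dots> = 1" by (intro cis_multiple_2pi) simp
  finally have "w ^ N = 1" .
  moreover have "w \<noteq> 1"
  proof
    assume "w = 1"
    then obtain i where "2 * pi * (real m - real l) / real N = of_int i * (2 * pi)"
      unfolding w_def cis_eq_1_iff by blast
    then have "2 * pi * (real m - real l) = 2 * pi * (of_int i * real N)"
      using assms by (simp add: field_simps)
    then have "real_of_int (int m - int l) = of_int (i * int N)" by simp
    then have "int m - int l = i * int N" by (simp only: of_int_eq_iff)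
    then have "int N dvd int m - int l" by simp
    then have "int N \<le> \<bar>int m - int l\<bar>" using False by (intro zdvd_imp_le) auto
    with assms show False by linarith
  qed
  ultimately show ?thesis
    using geometric_sum[of w N] False by (simp add: pow)
qed simp

lemma norm_cis_minus_one: "cmod (cis (2 * x) - 1) = 2 * \<bar>sin x\<bar>"
proof -
  have "cis (2 * x) - 1 = - (1 + cis (2 * (x + pi / 2)))"
    by (simp add: distrib_left flip: minus_cis)
  then show ?thesis using norm_one_plus_cis[of "x + pi / 2"]
    by (simp only: norm_minus_cancel) (simp add: cos_add)
qed

text \<open>Jordan's inequality applies to whichever of \<open>k\<close> and \<open>N - k\<close> is
  at most N / 2. Adding both reciprocals dominates either case and is easy to sum over
  \<open>k\<close>.\<close>

lemma inverse_square_chord_le: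
  assumes "0 < k" "k < N"
  shows "1 / (cmod (cis (- (2 * pi * real k / real N)) - 1))\<^sup>2
    \<le> (real N)\<^sup>2 / 16 * (1 / (real k)\<^sup>2 + 1 / (real (N - k))\<^sup>2)"
proof -
  have chord: "cmod (cis (- (2 * pi * real k / real N)) - 1) = 2 * \<bar>sin (pi * real k / real N)\<bar>"
    using norm_cis_minus_one[of "- (pi * real k / real N)"] by (simp add: mult.assoc)
  have "\<exists>j\<in>{k, N - k}. 2 * (real j / real N) \<le> sin (pi * real k / real N)"
  proof (cases "2 * k \<le> N")
    case True
    then have "real k * 2 \<le> real N" by linarith
    then have "2 / pi * (pi * real k / real N) \<le> sin (pi * real k / real N)"
      using assms by (intro sin_ge_Jordan) (simp_all add: field_simps)
    then show ?thesis by simp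
  next
    case False
    have eq: "pi * real (N - k) / real N = pi - pi * real k / real N"
      using assms by (simp add: field_simps of_nat_diff)
    from False have "real (N - k) * 2 \<le> real N" using assms by linarith
    then have "2 / pi * (pi * real (N - k) / real N) \<le> sin (pi * real (N - k) / real N)"
      using assms by (intro sin_ge_Jordan) (simp_all add: field_simps)
    also have "2 / pi * (pi * real (N - k) / real N) = 2 * (real (N - k) / real N)" by simp
    also have "sin (pi * real (N - k) / real N) = sin (pi * real k / real N)" by (simp only: eq sin_pi_minus)
    finally show ?thesis by blast
  qed
  then obtain j where j: "j \<in> {k, N - k}" "2 * (real j / real N) \<le> sin (pi * real k / real N)" by blast
  have "0 < j" using j assms by auto
  then have "(4 * (real j / real N))\<^sup>2 \<le> (cmod (cis (- (2 * pi * real k / real N)) - 1))\<^sup>2"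
    unfolding chord using j by (intro power_mono) auto
  then have "1 / (cmod (cis (- (2 * pi * real k / real N)) - 1))\<^sup>2 \<le> 1 / (4 * (real j / real N))\<^sup>2"
    using assms \<open>0 < j\<close> by (intro frac_le) auto
  also have "\<dots> = (real N)\<^sup>2 / 16 * (1 / (real j)\<^sup>2)"
    by (simp add: power_mult_distrib power_divide)
  also have "\<dots> \<le> (real N)\<^sup>2 / 16 * (1 / (real k)\<^sup>2 + 1 / (real (N - k))\<^sup>2)"
    using j by (intro mult_left_mono) auto
  finally show ?thesis .
qed

text \<open>The quadratic multiplier is realised by a combination of the translates by \<open>k / N\<close>. Its
  coefficients, the discrete Fourier transform of a parabola, decay quadratically, so that their
  absolute sum is of order \<open>N\<^sup>2\<close>.\<close>

lemma norm_quadratic_multiplier_le: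
  fixes a :: "nat \<Rightarrow> complex"
  assumes "0 < N" and bound: "\<And>x. cmod (\<Sum>m<N. a m * cis (2 * pi * real m * x)) \<le> A"
  shows "cmod (\<Sum>m<N. of_real ((real m - (real N - 1) / 2)\<^sup>2) * (a m * cis (2 * pi * real m * x)))
    \<le> 7 / 12 * (real N)\<^sup>2 * A"
proof -
  define \<tau> where "\<tau> m = (real m - (real N - 1) / 2)\<^sup>2" for m
  define W where "W k = (\<Sum>l<N. of_real (\<tau> l) * cis (- (2 * pi * real k / real N)) ^ l)" for k :: nat
  define F where "F x = (\<Sum>m<N. a m * cis (2 * pi * real m * x))" for x
  have "0 \<le> A" using bound[of 0] norm_ge_zero order_trans by blast
  have expand: "W k * F (x + real k / real N) =
      (\<Sum>l<N. \<Sum>m<N. of_real (\<tau> l) * (a m * cis (2 * pi * real m * x)) *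
        cis (2 * pi * (real m - real l) * real k / real N))" for k
    unfolding W_def F_def sum_product
  proof (intro sum.cong refl)
    fix l m
    have "cis (- (2 * pi * real k / real N)) ^ l * cis (2 * pi * real m * (x + real k / real N)) =
      cis (2 * pi * real m * x) * cis (2 * pi * (real m - real l) * real k / real N)"
      unfolding Complex.DeMoivre cis_mult using assms(1) by (intro arg_cong[where f = cis]) (simp add: field_simps)
    then show "of_real (\<tau> l) * cis (- (2 * pi * real k / real N)) ^ l *
        (a m * cis (2 * pi * real m * (x + real k / real N))) =
      of_real (\<tau> l) * (a m * cis (2 * pi * real m * x)) * cis (2 * pi * (real m - real l) * real k / real N)"
      by (simp only: mult_ac)
  qed
  have "(\<Sum>k<N. W k * F (x + real k / real N)) =
      (\<Sum>k<N. \<Sum>l<N. \<Sum>m<N. of_real (\<tau> l) * (a m * cis (2 * pi * real m * x)) *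
        cis (2 * pi * (real m - real l) * real k / real N))"
    by (simp only: expand)
  also have "\<dots> = (\<Sum>l<N. \<Sum>m<N. of_real (\<tau> l) * (a m * cis (2 * pi * real m * x)) *
        (\<Sum>k<N. cis (2 * pi * (real m - real l) * real k / real N)))"
    by (rule trans[OF sum.swap], rule sum.cong[OF refl], rule trans[OF sum.swap], simp only: sum_distrib_left)
  also have "\<dots> = (\<Sum>l<N. \<Sum>m<N. if m = l then of_nat N * (of_real (\<tau> l) * (a m * cis (2 * pi * real m * x))) else 0)"
    by (intro sum.cong refl) (auto simp: sum_cis_orthogonal)
  also have "\<dots> = of_nat N * (\<Sum>l<N. of_real (\<tau> l) * (a l * cis (2 * pi * real l * x)))"
    by (simp add: sum.delta' sum_distrib_left)
  finally have "real N * cmod (\<Sum>l<N. of_real (\<tau> l) * (a l * cis (2 * pi * real l * x)))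
      = cmod (\<Sum>k<N. W k * F (x + real k / real N))"
    by (simp add: norm_mult)
  also have "\<dots> \<le> (\<Sum>k<N. cmod (W k) * A)"
    by (intro order_trans[OF norm_sum] sum_mono)
       (auto simp: norm_mult F_def intro!: mult_left_mono bound)
  also have "\<dots> = (cmod (W 0) + (\<Sum>k=1..N-1. cmod (W k))) * A"
  proof -
    have "{..<N} = insert 0 {1..N-1}" using assms(1) by auto
    then show ?thesis by (simp add: sum_distrib_right distrib_right)
  qed
  \<comment> \<open>The zero frequency gives 1/12, the others (1/8) * (2 + 2) = 1/2, together 7/12.
    One power of \<open>N\<close> cancels against the factor from orthogonality.\<close>
  also have "\<dots> \<le> (real N ^ 3 / 12 + real N ^ 3 / 2) * A"
  proof (intro mult_right_mono add_mono \<open>0 \<le> A\<close>)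
    have "W 0 = of_real (\<Sum>l<N. \<tau> l)" by (simp add: W_def)
    then show "cmod (W 0) \<le> real N ^ 3 / 12"
      using sum_centred_squares_le[of N] by (simp add: \<tau>_def sum_nonneg del: of_real_sum)
    have "cmod (W k) \<le> real N ^ 3 / 8 * (1 / (real k)\<^sup>2 + 1 / (real (N - k))\<^sup>2)"
      if k: "k \<in> {1..N-1}" for k
    proof -
      define w where "w = cis (- (2 * pi * real k / real N))"
      have k': "0 < k" "k < N" using k by auto
      have "w ^ N = cis (- (2 * pi * of_nat k))" using k' by (simp add: w_def Complex.DeMoivre)
      also have "\<dots> = cis (2 * pi * (- of_nat k))" by simp
      also have "\<dots> = 1" by (intro cis_multiple_2pi) simp
      finally have wN: "w ^ N = 1" .
      have chord: "1 / (cmod (w - 1))\<^sup>2 \<le> (real N)\<^sup>2 / 16 * (1 / (real k)\<^sup>2 + 1 / (real (N - k))\<^sup>2)"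
        using inverse_square_chord_le[OF k'] by (simp add: w_def)
      have "sin (pi * real k / real N) > 0"
        using k' by (intro sin_gt_zero) (simp_all add: field_simps)
      then have "cmod (w - 1) \<noteq> 0"
        using norm_cis_minus_one[of "- (pi * real k / real N)"] by (simp add: w_def mult.assoc)
      then have pos: "(cmod (w - 1))\<^sup>2 > 0" and "w \<noteq> 1" by auto
      have "(cmod (w - 1))\<^sup>2 * cmod (W k) = cmod (- of_nat N * (1 + w))"
        using sum_centred_squares_root_unity[OF wN \<open>w \<noteq> 1\<close>, symmetric]
        by (simp add: W_def w_def \<tau>_def norm_mult norm_power)
      also have "\<dots> \<le> real N * 2"
        unfolding norm_mult using norm_triangle_ineq[of 1 w]
        by (intro mult_mono) (auto simp: w_def)
      finally have "cmod (W k) \<le> real N * 2 * (1 / (cmod (w - 1))\<^sup>2)"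
        using pos by (simp add: field_simps)
      also have "\<dots> \<le> real N * 2 * ((real N)\<^sup>2 / 16 * (1 / (real k)\<^sup>2 + 1 / (real (N - k))\<^sup>2))"
        by (intro mult_left_mono chord) simp
      finally show ?thesis by (simp add: power2_eq_square power3_eq_cube)
    qed
    then have "(\<Sum>k=1..N-1. cmod (W k))
        \<le> (\<Sum>k=1..N-1. real N ^ 3 / 8 * (1 / (real k)\<^sup>2 + 1 / (real (N - k))\<^sup>2))"
      by (rule sum_mono)
    also have "\<dots> = real N ^ 3 / 8 * ((\<Sum>k=1..N-1. 1 / (real k)\<^sup>2) + (\<Sum>k=1..N-1. 1 / (real (N - k))\<^sup>2))"
      by (simp only: sum_distrib_left flip: sum.distrib)
    also have "(\<Sum>k=1..N-1. 1 / (real (N - k))\<^sup>2) = (\<Sum>k=1..N-1. 1 / (real k)\<^sup>2)"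
      by (rule sum.reindex_bij_witness[of _ "\<lambda>k. N - k" "\<lambda>k. N - k"]) auto
    also have "real N ^ 3 / 8 * ((\<Sum>k=1..N-1. 1 / (real k)\<^sup>2) + (\<Sum>k=1..N-1. 1 / (real k)\<^sup>2))
        \<le> real N ^ 3 / 8 * (2 + 2)"
      by (intro mult_left_mono add_mono sum_inverse_squares_le) simp
    finally show "(\<Sum>k=1..N-1. cmod (W k)) \<le> real N ^ 3 / 2" by simp
  qed
  finally show ?thesis
    using assms(1) by (simp add: \<tau>_def power2_eq_square power3_eq_cube field_simps)
qed

text \<open>A weak form of Bernstein's inequality: near its maximum \<open>x\<^sub>0\<close> the modulus is bounded
  below by the real part of a rotated, frequency-centred copy, whose first derivative vanishes at
  \<open>x\<^sub>0\<close> and whose second derivative is \<open>O(N\<^sup>2 A)\<close>.\<close>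

lemma exponential_sum_near_max:
  fixes a :: "nat \<Rightarrow> complex"
  assumes "0 < N"
    and bound: "\<And>x. cmod (\<Sum>m<N. a m * cis (2 * pi * real m * x)) \<le> A"
    and max: "cmod (\<Sum>m<N. a m * cis (2 * pi * real m * x0)) = A"
  shows "A * (1 - 12 * (real N * (y - x0))\<^sup>2) \<le> cmod (\<Sum>m<N. a m * cis (2 * pi * real m * y))"
proof -
  define \<nu> where "\<nu> m = 2 * pi * (real m - (real N - 1) / 2)" for m
  define F where "F x = (\<Sum>m<N. a m * cis (2 * pi * real m * x))" for x
  define \<phi> where "\<phi> = - Arg (\<Sum>m<N. a m * cis (\<nu> m * x0))"
  define r where "r x = (\<Sum>m<N. Re (a m * cis (\<nu> m * x + \<phi>)))" for x
  define r' where "r' x = (\<Sum>m<N. Re (\<i> * \<nu> m * (a m * cis (\<nu> m * x + \<phi>))))" for x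
  define r'' where "r'' x = (\<Sum>m<N. Re (- (of_real ((\<nu> m)\<^sup>2) * (a m * cis (\<nu> m * x + \<phi>)))))" for x
  define u where "u x = cis (\<phi> - pi * (real N - 1) * x)" for x
  have u: "cis (\<nu> m * x + \<phi>) = u x * cis (2 * pi * real m * x)" for m x
    unfolding u_def cis_mult by (intro arg_cong[where f = cis]) (simp add: \<nu>_def field_simps)
  have "0 \<le> A" using max norm_ge_zero by metis
  have r_eq: "r x = Re (u x * F x)" for x
    unfolding r_def Re_sum[symmetric] F_def sum_distrib_left
    by (intro arg_cong[where f = Re] sum.cong refl) (simp only: u, simp only: mult_ac)
  have u_norm: "cmod (u x) = 1" for x by (simp add: u_def)
  have r_le: "r x \<le> cmod (F x)" for x
    unfolding r_eq using complex_Re_le_cmod[of "u x * F x"] by (simp add: norm_mult u_norm)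
  have "r x0 = A"
  proof -
    define z where "z = (\<Sum>m<N. a m * cis (\<nu> m * x0))"
    have "z * cis \<phi> = u x0 * F x0"
      unfolding z_def F_def sum_distrib_left sum_distrib_right
      by (rule sum.cong[OF refl]) (simp only: mult.assoc cis_mult u, simp only: mult_ac)
    then have "cmod (z * cis \<phi>) = cmod (u x0 * F x0)" by simp
    then have "cmod z = A" using max u_norm[of x0] by (simp add: F_def norm_mult)
    have "z * cis \<phi> = of_real (cmod z)"
    proof -
      have "\<phi> = - Arg z" by (simp add: \<phi>_def z_def)
      then have "rcis (cmod z) (Arg z) * cis \<phi> = of_real (cmod z)"
        by (simp add: rcis_def cis_mult mult.assoc)
      then show ?thesis by (simp only: rcis_cmod_Arg)
    qed
    then show ?thesis unfolding r_eq using \<open>z * cis \<phi> = u x0 * F x0\<close> \<open>cmod z = A\<close> by simp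
  qed
  have d1: "(r has_real_derivative r' x) (at x)" for x
    unfolding r_def r'_def
    by (auto intro!: derivative_eq_intros sum.cong simp: algebra_simps)
  have d2: "(r' has_real_derivative r'' x) (at x)" for x
    unfolding r'_def r''_def
    by (auto intro!: derivative_eq_intros sum.cong simp: algebra_simps power2_eq_square)
  have "r' x0 = 0"
  proof (rule DERIV_local_max[OF d1, of 1])
    show "\<forall>y. \<bar>x0 - y\<bar> < 1 \<longrightarrow> r y \<le> r x0"
      using r_le bound \<open>r x0 = A\<close> unfolding F_def by (metis order_trans)
  qed simp
  \<comment> \<open>24 rounds up 4 pi^2 * 7/12 = 7 pi^2 / 3, which is about 23.03.\<close>
  have r''_bound: "\<bar>r'' x\<bar> \<le> 24 * (real N)\<^sup>2 * A" for x
  proof -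
    have \<nu>_square: "(\<nu> m)\<^sup>2 = 4 * pi\<^sup>2 * (real m - (real N - 1) / 2)\<^sup>2" for m
      by (simp add: \<nu>_def power_mult_distrib)
    have "r'' x = Re (- (of_real (4 * pi\<^sup>2) * u x *
        (\<Sum>m<N. of_real ((real m - (real N - 1) / 2)\<^sup>2) * (a m * cis (2 * pi * real m * x)))))"
      unfolding r''_def sum_distrib_left Re_sum[symmetric] sum_negf[symmetric]
      by (intro arg_cong[where f = Re] sum.cong refl) (simp only: u \<nu>_square of_real_mult, simp only: mult_ac)
    also have "\<bar>\<dots>\<bar> \<le> 4 * pi\<^sup>2 * cmod (\<Sum>m<N. of_real ((real m - (real N - 1) / 2)\<^sup>2) * (a m * cis (2 * pi * real m * x)))"
      by (intro order_trans[OF abs_Re_le_cmod]) (simp add: norm_mult norm_power u_norm)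
    also have "\<dots> \<le> 4 * pi\<^sup>2 * (7 / 12 * (real N)\<^sup>2 * A)"
      by (intro mult_left_mono norm_quadratic_multiplier_le assms) simp
    also have "\<dots> = pi\<^sup>2 * (7 / 3) * ((real N)\<^sup>2 * A)" by simp
    also have "\<dots> \<le> 24 * ((real N)\<^sup>2 * A)"
    proof (intro mult_right_mono mult_nonneg_nonneg \<open>0 \<le> A\<close>)
      have "pi\<^sup>2 \<le> 3.15\<^sup>2" using pi_approx by (intro power_mono) auto
      then show "pi\<^sup>2 * (7 / 3) \<le> 24" by (simp add: power2_eq_square)
    qed simp
    finally show ?thesis by simp
  qed
  \<comment> \<open>The added parabola outweighs \<open>r''\<close>, so \<open>g\<close> is convex
    with critical point \<open>x0\<close>, hence minimal there. This replaces a Taylor expansion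
    with remainder.\<close>
  define g where "g x = r x + 12 * (real N)\<^sup>2 * A * (x - x0)\<^sup>2" for x
  have "convex_on UNIV g"
  proof (rule f''_ge0_imp_convex)
    show "(g has_real_derivative r' x + 24 * (real N)\<^sup>2 * A * (x - x0)) (at x)" for x
      unfolding g_def by (auto intro!: derivative_eq_intros d1)
    show "((\<lambda>x. r' x + 24 * (real N)\<^sup>2 * A * (x - x0)) has_real_derivative r'' x + 24 * (real N)\<^sup>2 * A) (at x)" for x
      by (auto intro!: derivative_eq_intros d2)
    show "0 \<le> r'' x + 24 * (real N)\<^sup>2 * A" for x
      using r''_bound[of x] by linarith
  qed simp
  moreover have "(g has_real_derivative 0) (at x0 within UNIV)"
    unfolding g_def using \<open>r' x0 = 0\<close> by (auto intro!: derivative_eq_intros d1)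
  ultimately have "g x0 \<le> g y"
    using convex_on_imp_above_tangent[of UNIV g x0 y 0] by simp
  then have "A \<le> r y + 12 * (real N)\<^sup>2 * A * (y - x0)\<^sup>2"
    by (simp add: g_def \<open>r x0 = A\<close>)
  moreover have "A * (1 - 12 * (real N * (y - x0))\<^sup>2) = A - 12 * (real N)\<^sup>2 * A * (y - x0)\<^sup>2"
    unfolding power_mult_distrib by (simp add: right_diff_distrib mult_ac)
  ultimately show ?thesis
    using r_le[of y] unfolding F_def by linarith
qed

section \<open>Maxima of the cosine product and periodic points\<close>

lemma cos_pi_eq_zeroE:
  assumes "cos (pi * z) = 0"
  obtains i :: int where "2 * z = of_int (2 * i + 1)"
proof -
  obtain j where "odd j" "pi * z = of_int j * (pi / 2)"
    using assms unfolding cos_zero_iff_int by blast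
  then obtain i where "pi * z = of_int (2 * i + 1) * (pi / 2)" by (auto elim: oddE)
  then have "2 * z = of_int (2 * i + 1)" by simp
  then show thesis by (rule that)
qed

lemma cos_prod_2: "cos_prod c 2 w = \<bar>cos (pi * (w + c))\<bar> * \<bar>cos (pi * (2 * w + c))\<bar>"
  by (simp add: cos_prod_def numeral_2_eq_2)

text \<open>If the same factor vanished at both points, its arguments would differ by 1/4 or 1/2,
  but zeros of cos(pi z) are a positive integer apart. If different factors vanish, eliminating
  \<open>w\<close> makes \<open>c\<close> an integer.\<close>

lemma cos_prod_2_no_common_zero:
  assumes "0 < c" "c < 1"
  shows "0 < cos_prod c 2 w + cos_prod c 2 (w + 1 / 4)"
proof (rule ccontr)
  assume "\<not> ?thesis"
  then have "cos_prod c 2 w = 0" "cos_prod c 2 (w + 1 / 4) = 0"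
    using cos_prod_nonneg[of c 2 w] cos_prod_nonneg[of c 2 "w + 1 / 4"] by linarith+
  then obtain z z' where z: "z \<in> {w + c, 2 * w + c}" "cos (pi * z) = 0"
    and z': "z' \<in> {w + 1 / 4 + c, 2 * (w + 1 / 4) + c}" "cos (pi * z') = 0"
    unfolding cos_prod_2 by auto
  obtain i :: int where i: "2 * z = of_int (2 * i + 1)" by (rule cos_pi_eq_zeroE[OF z(2)])
  obtain j :: int where j: "2 * z' = of_int (2 * j + 1)" by (rule cos_pi_eq_zeroE[OF z'(2)])
  note ij = i j
  have no_int: "c \<noteq> of_int m" for m :: int
  proof
    assume "c = of_int m"
    with assms have "0 < m" "m < 1" by simp_all
    then show False by simp
  qed
  consider "z = w + c" "z' = w + 1 / 4 + c" | "z = w + c" "z' = 2 * (w + 1 / 4) + c"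
    | "z = 2 * w + c" "z' = w + 1 / 4 + c" | "z = 2 * w + c" "z' = 2 * (w + 1 / 4) + c"
    using z(1) z'(1) by blast
  then show False
  proof cases
    case 1
    then have "real_of_int (4 * (j - i)) = of_int 1" using ij by simp
    then have "4 * (j - i) = 1" by (simp only: of_int_eq_iff)
    then show False by presburger
  next
    case 2
    then have "c = of_int (2 * i + 1 - j)" using ij by simp
    with no_int show False by blast
  next
    case 3
    then have "c = of_int (2 * j - i)" using ij by simp
    with no_int show False by blast
  next
    case 4
    then have "real_of_int (2 * (j - i)) = of_int 1" using ij by simp
    then have "2 * (j - i) = 1" by (simp only: of_int_eq_iff)
    then show False by presburger
  qed
qed

lemma cos_prod_2_bounded_below:
  assumes "0 < c" "c < 1"
  obtains \<kappa> where "0 < \<kappa>" "\<And>w. \<kappa> \<le> cos_prod c 2 w + cos_prod c 2 (w + 1 / 4)"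
proof -
  define h where "h w = cos_prod c 2 w + cos_prod c 2 (w + 1 / 4)" for w
  have "continuous_on {0..1} h"
    unfolding h_def
    by (intro continuous_intros continuous_on_compose2[OF continuous_on_cos_prod[of UNIV c 2]]) auto
  then obtain w0 where w0: "\<forall>w\<in>{0..1}. h w0 \<le> h w"
    using continuous_attains_inf[of "{0..1::real}" h] by auto
  have "h w0 \<le> h w" for w
  proof -
    have "cong_mod_one (w + 1 / 4) (frac w + 1 / 4)" by (simp add: cong_mod_one_def frac_def)
    then have "h w = h (frac w)"
      unfolding h_def using cos_prod_cong[OF cong_mod_one_frac[of w]] cos_prod_cong by auto
    moreover have "frac w \<in> {0..1}" using frac_lt_1[of w] by simp
    ultimately show ?thesis using w0 by simp
  qed
  then show thesis
    using that cos_prod_2_no_common_zero[OF assms] unfolding h_def by blast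
qed

lemma abs_cos_diff_le: "\<bar>cos x - cos y\<bar> \<le> \<bar>x - y\<bar>" for x y :: real
proof -
  have "\<bar>cos x - cos y\<bar> = 2 * \<bar>sin ((x + y) / 2)\<bar> * \<bar>sin ((y - x) / 2)\<bar>"
    by (simp add: cos_diff_cos abs_mult)
  also have "\<dots> \<le> 2 * 1 * \<bar>(y - x) / 2\<bar>"
    by (intro mult_mono abs_sin_x_le_abs_x) auto
  finally show ?thesis by simp
qed

text \<open>Factor k contributes pi 2^k, and these sum to less than pi 2^n. Needed for two factors
  only: the images of neighbouring periodic points differ by almost, but not exactly, 1/4.\<close>

lemma cos_prod_Lipschitz: "\<bar>cos_prod c n x - cos_prod c n y\<bar> \<le> pi * 2 ^ n * \<bar>x - y\<bar>"
proof (induction n)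
  case 0
  then show ?case by (simp add: cos_prod_def)
next
  case (Suc n)
  let ?a = "\<lambda>x. \<bar>cos (pi * (2 ^ n * x + c))\<bar>"
  have "\<bar>?a x - ?a y\<bar> \<le> \<bar>cos (pi * (2 ^ n * x + c)) - cos (pi * (2 ^ n * y + c))\<bar>" by simp
  also have "\<dots> \<le> \<bar>pi * (2 ^ n * x + c) - pi * (2 ^ n * y + c)\<bar>" by (rule abs_cos_diff_le)
  also have "\<dots> = \<bar>pi * 2 ^ n * (x - y)\<bar>" by (simp add: algebra_simps)
  finally have a: "\<bar>?a x - ?a y\<bar> \<le> pi * 2 ^ n * \<bar>x - y\<bar>" by (simp add: abs_mult)
  have "cos_prod c (Suc n) x - cos_prod c (Suc n) y =
      (cos_prod c n x - cos_prod c n y) * ?a x + cos_prod c n y * (?a x - ?a y)"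
    by (simp add: cos_prod_def algebra_simps)
  also have "\<bar>\<dots>\<bar> \<le> \<bar>cos_prod c n x - cos_prod c n y\<bar> * 1 + 1 * \<bar>?a x - ?a y\<bar>"
    by (intro order_trans[OF abs_triangle_ineq] add_mono, unfold abs_mult) (intro mult_mono; simp)+
  finally show ?case using Suc a by simp
qed

lemma cos_prod_attains_max:
  obtains x0 where "x0 \<in> {0..1}" "\<And>x. cos_prod c n x \<le> cos_prod c n x0"
proof -
  obtain x0 where x0: "x0 \<in> {0..1}" "\<And>x. x \<in> {0..1} \<Longrightarrow> cos_prod c n x \<le> cos_prod c n x0"
    using continuous_attains_sup[of "{0..1::real}" "cos_prod c n"] continuous_on_cos_prod by auto
  have "cos_prod c n x \<le> cos_prod c n x0" for x
  proof -
    have "frac x \<in> {0..1}" using frac_lt_1[of x] by simp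
    then show ?thesis using x0(2)[of "frac x"] cos_prod_cong[OF cong_mod_one_frac[of x]] by simp
  qed
  with x0(1) show thesis by (rule that)
qed

lemma cos_prod_near_max:
  assumes "\<And>x. cos_prod c n x \<le> cos_prod c n x0"
  shows "cos_prod c n x0 * (1 - 12 * (2 ^ n * (y - x0))\<^sup>2) \<le> cos_prod c n y"
proof -
  have sum: "cmod (\<Sum>m<2 ^ n. thue_morse c m * cis (2 * pi * real m * x)) = 2 ^ n * cos_prod c n x" for x
    using norm_thue_morse_sum_power2[of c n x] by (simp add: thue_morse_sum_def)
  have "2 ^ n * cos_prod c n x0 * (1 - 12 * (real (2 ^ n) * (y - x0))\<^sup>2)
      \<le> cmod (\<Sum>m<2 ^ n. thue_morse c m * cis (2 * pi * real m * y))"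
    by (rule exponential_sum_near_max) (simp_all add: sum assms)
  then show ?thesis unfolding sum by (simp add: mult.assoc)
qed

text \<open>Points of period \<open>n + 2\<close> are spaced by about \<open>1 / 4\<close> of the scale \<open>2 ^ - n\<close> on which
  \<open>cos_prod c n\<close> varies. At both neighbours of a maximum of \<open>cos_prod c n\<close> this product is
  comparable to the maximum, and at one of them the two remaining factors are not small.\<close>

lemma periodic_point_near_max:
  assumes "0 < c" "c < 1"
  obtains C n0 where "0 < C"
    "\<And>n. n0 \<le> n \<Longrightarrow> \<exists>y. (2 ^ (n + 2) - 1) * y \<in> \<int> \<and> (\<forall>x. cos_prod c n x \<le> C * cos_prod c (n + 2) y)"
proof -
  obtain \<kappa> where \<kappa>: "0 < \<kappa>" "\<And>w. \<kappa> \<le> cos_prod c 2 w + cos_prod c 2 (w + 1 / 4)"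
    using cos_prod_2_bounded_below[OF assms] by blast
  obtain n1 where n1: "2 * pi / \<kappa> < 2 ^ n1"
    using real_arch_pow[of 2] by force
  \<comment> \<open>A factor 10 is lost by moving away from the maximum and 4 / \<kappa> in the last
    two factors. The threshold on \<open>n\<close> has two parts: 2 yields
    \<open>D \<ge> 15/4 * 2 ^ n\<close>, and \<open>n1\<close> makes the Lipschitz error at most
    \<kappa> / 2.\<close>
  have "\<exists>y. (2 ^ (n + 2) - 1) * y \<in> \<int> \<and> (\<forall>x. cos_prod c n x \<le> 40 / \<kappa> * cos_prod c (n + 2) y)"
    if n: "max 2 n1 \<le> n" for n
  proof -
    define D where "D = (2 ^ (n + 2) - 1 :: real)"
    have D: "D = 4 * 2 ^ n - 1" by (simp add: D_def)
    have "(4::real) \<le> 2 ^ n" using power_increasing[of 2 n "2::real"] n by simp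
    then have D_ge1: "15 / 4 * 2 ^ n \<le> D" unfolding D by linarith
    have "(2::real) ^ n1 \<le> 2 ^ n" using n by (intro power_increasing) auto
    have "(1::real) \<le> 2 ^ n" by simp
    then have D_ge2: "2 * pi / \<kappa> \<le> D" using n1 \<open>2 ^ n1 \<le> 2 ^ n\<close> unfolding D by linarith
    have "0 < D" using D_ge1 by (rule less_le_trans[rotated]) simp
    obtain x0 where x0: "\<And>x. cos_prod c n x \<le> cos_prod c n x0"
      using cos_prod_attains_max by blast
    \<comment> \<open>\<open>y0\<close> and \<open>y1\<close> are the multiples of 1 / D enclosing
      \<open>x0\<close>; modulo 1 such points have period \<open>n + 2\<close>.\<close>
    define y0 where "y0 = of_int \<lfloor>x0 * D\<rfloor> / D"
    define y1 where "y1 = y0 + 1 / D"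
    have "y0 \<le> x0" "x0 \<le> y1"
      unfolding y1_def y0_def using \<open>0 < D\<close> by (simp_all add: field_simps) linarith+
    then have near: "\<bar>y - x0\<bar> \<le> 1 / D" if "y \<in> {y0, y1}" for y
      using that by (auto simp: y1_def)
    have large: "cos_prod c n x0 / 10 \<le> cos_prod c n y" if "y \<in> {y0, y1}" for y
    proof -
      have "\<bar>2 ^ n * (y - x0)\<bar> \<le> 2 ^ n * (1 / D)"
        unfolding abs_mult using near[OF that] by (intro mult_mono) auto
      also have "\<dots> \<le> 4 / 15" using D_ge1 \<open>0 < D\<close> by (simp add: field_simps)
      finally have "\<bar>2 ^ n * (y - x0)\<bar> \<le> \<bar>4 / 15\<bar>" by simp
      then have "(2 ^ n * (y - x0))\<^sup>2 \<le> (4 / 15)\<^sup>2" by (simp only: abs_le_square_iff)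
      moreover have "(4 / 15 :: real)\<^sup>2 = 16 / 225" by (simp add: power2_eq_square)
      \<comment> \<open>This is where the Bernstein constant matters: 12 * 16/225 is about 0.853,
        still below 1.\<close>
      ultimately have "1 / 10 \<le> 1 - 12 * (2 ^ n * (y - x0))\<^sup>2" by linarith
      then have "cos_prod c n x0 * (1 / 10) \<le> cos_prod c n x0 * (1 - 12 * (2 ^ n * (y - x0))\<^sup>2)"
        by (intro mult_left_mono) auto
      also have "\<dots> \<le> cos_prod c n y" by (intro cos_prod_near_max x0)
      finally show ?thesis by simp
    qed
    \<comment> \<open>Since \<open>2 ^ n = (D + 1) / 4\<close>, the images of the neighbours are 1/4
      + 1 / (4 D) apart.\<close>
    have "2 ^ n * y1 - (2 ^ n * y0 + 1 / 4) = 1 / (4 * D)"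
      using \<open>0 < D\<close> by (simp add: y1_def D field_simps)
    then have "\<bar>cos_prod c 2 (2 ^ n * y1) - cos_prod c 2 (2 ^ n * y0 + 1 / 4)\<bar> \<le> pi / D"
      using cos_prod_Lipschitz[of c 2 "2 ^ n * y1" "2 ^ n * y0 + 1 / 4"] \<open>0 < D\<close> by simp
    also have "\<dots> \<le> \<kappa> / 2" using D_ge2 \<open>0 < D\<close> \<kappa>(1) by (simp add: field_simps)
    finally have "\<kappa> / 2 \<le> cos_prod c 2 (2 ^ n * y0) + cos_prod c 2 (2 ^ n * y1)"
      using \<kappa>(2)[of "2 ^ n * y0"] by linarith
    then obtain y where y: "y \<in> {y0, y1}" "\<kappa> / 4 \<le> cos_prod c 2 (2 ^ n * y)"
      by (cases "\<kappa> / 4 \<le> cos_prod c 2 (2 ^ n * y0)") (force, fastforce)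
    have "cos_prod c n x0 / 10 * (\<kappa> / 4) \<le> cos_prod c n y * cos_prod c 2 (2 ^ n * y)"
      using y \<kappa>(1) by (intro mult_mono large) auto
    then have "cos_prod c n x0 \<le> 40 / \<kappa> * cos_prod c (n + 2) y"
      unfolding cos_prod_add using \<kappa>(1) by (simp add: field_simps)
    moreover have "D * y \<in> \<int>"
      using y(1) \<open>0 < D\<close> by (auto simp: y1_def y0_def distrib_left)
    ultimately show ?thesis
      unfolding D_def using x0 order_trans by blast
  qed
  moreover have "0 < 40 / \<kappa>" using \<kappa>(1) by simp
  ultimately show thesis using that by blast
qed

section \<open>Invariant measures on the torus\<close>

lemma open_torus_iff: "open U \<longleftrightarrow> open (abs_torus -` U)"
  by (rule open_torus_def)

lemma abs_torus_eq_iff: "abs_torus x = abs_torus y \<longleftrightarrow> x - y \<in> \<int>"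
  by (simp add: torus.abs_eq_iff cong_mod_one_def)

text \<open>The universal property of the quotient topology. Borel measurability on the torus is
  derived from continuity on the line through it.\<close>

lemma continuous_on_torus:
  fixes h :: "torus \<Rightarrow> 'a::topological_space"
  assumes "continuous_on UNIV (\<lambda>x. h (abs_torus x))"
  shows "continuous_on UNIV h"
  unfolding continuous_on_open_vimage[OF open_UNIV]
proof (intro allI impI)
  fix B :: "'a set" assume "open B"
  then have "open ((\<lambda>x. h (abs_torus x)) -` B \<inter> UNIV)"
    using assms unfolding continuous_on_open_vimage[OF open_UNIV] by blast
  moreover have "(\<lambda>x. h (abs_torus x)) -` B = abs_torus -` (h -` B)" by auto
  ultimately show "open (h -` B \<inter> UNIV)" by (simp add: open_torus_iff)
qed

lemma continuous_on_abs_torus: "continuous_on UNIV abs_torus"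
  unfolding continuous_on_open_vimage[OF open_UNIV] by (simp add: open_torus_iff)

lemma measurable_doubling [measurable]: "doubling \<in> borel \<rightarrow>\<^sub>M borel"
  by (intro borel_measurable_continuous_onI continuous_on_torus)
     (auto simp: doubling.abs_eq intro!: continuous_on_compose2[OF continuous_on_abs_torus] continuous_intros)

text \<open>A continuous real function through which the measurability of the extended-real
  \<open>potential\<close> is obtained.\<close>

lift_definition abs_cos :: "real \<Rightarrow> torus \<Rightarrow> real" is "\<lambda>c x. \<bar>cos (pi * (x + c))\<bar>"
  by (rule abs_cos_pi_cong)

lemma measurable_abs_cos [measurable]: "abs_cos c \<in> borel_measurable borel"
  by (intro borel_measurable_continuous_onI continuous_on_torus)
     (auto simp: abs_cos.abs_eq intro!: continuous_intros)

lemma potential_eq: "potential c t = (if abs_cos c t = 0 then - \<infinity> else ereal (ln (abs_cos c t)))"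
  by transfer simp

lemma measurable_potential [measurable]: "potential c \<in> borel_measurable borel"
  unfolding potential_eq[abs_def] by measurable

lemma potential_nonpos: "potential c t \<le> 0"
  by transfer (simp add: ln_le_zero_iff)

lemma funpow_doubling: "(doubling ^^ k) (abs_torus x) = abs_torus (2 ^ k * x)"
  by (induction k) (simp_all add: doubling.abs_eq mult.assoc)

lemma e2ennreal_minus_potential:
  "e2ennreal (- potential c (abs_torus x)) =
    (if cos (pi * (x + c)) = 0 then \<infinity> else ennreal (- ln \<bar>cos (pi * (x + c))\<bar>))"
  by (simp add: potential.abs_eq)

text \<open>The potential is nonpositive, so its negative can be summed in \<open>ennreal\<close>,
  where infinite terms are harmless: one zero factor makes the sum infinite.\<close>

lemma sum_potential_orbit:
  "(\<Sum>k<n. e2ennreal (- potential c (abs_torus (2 ^ k * x)))) =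
    (if cos_prod c n x = 0 then \<infinity> else ennreal (- ln (cos_prod c n x)))"
proof (induction n)
  case 0
  then show ?case by (simp add: cos_prod_def)
next
  case (Suc n)
  have Suc_eq: "cos_prod c (Suc n) x = cos_prod c n x * \<bar>cos (pi * (2 ^ n * x + c))\<bar>"
    by (simp add: cos_prod_def)
  have "ln (cos_prod c n x) \<le> 0" if "cos_prod c n x \<noteq> 0"
    using that cos_prod_nonneg[of c n x] by (simp add: ln_le_zero_iff order_less_le)
  moreover have "ln \<bar>cos (pi * (2 ^ n * x + c))\<bar> \<le> 0" if "cos (pi * (2 ^ n * x + c)) \<noteq> 0"
    using that by (simp add: ln_le_zero_iff)
  moreover have "0 < cos_prod c n x" if "cos_prod c n x \<noteq> 0"
    using that cos_prod_nonneg[of c n x] by linarith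
  ultimately show ?case
    unfolding sum.lessThan_Suc Suc.IH
    by (auto simp: Suc_eq e2ennreal_minus_potential ln_mult ennreal_plus[symmetric] simp del: ennreal_plus)
qed

lemma ereal_integral_potential:
  "ereal_integral \<mu> (potential c) = - enn2ereal (\<integral>\<^sup>+t. e2ennreal (- potential c t) \<partial>\<mu>)"
  unfolding ereal_integral_def by (simp add: e2ennreal_neg potential_nonpos zero_ennreal.rep_eq)

lemma invariant_measuresD:
  assumes "\<mu> \<in> invariant_measures"
  shows "prob_space \<mu>" "sets \<mu> = sets borel" "distr \<mu> borel doubling = \<mu>"
  using assms by (auto simp: invariant_measures_def)

lemma nn_integral_funpow_doubling:
  assumes "\<mu> \<in> invariant_measures" and [measurable]: "u \<in> borel_measurable borel"
  shows "(\<integral>\<^sup>+t. u ((doubling ^^ k) t) \<partial>\<mu>) = (\<integral>\<^sup>+t. u t \<partial>\<mu>)"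
proof (induction k)
  case (Suc k)
  note [measurable_cong] = invariant_measuresD(2)[OF assms(1)]
  have [measurable]: "(doubling ^^ k) \<in> borel \<rightarrow>\<^sub>M borel"
    by (induction k) (simp_all add: measurable_doubling measurable_comp)
  have "(\<integral>\<^sup>+t. u ((doubling ^^ k) t) \<partial>\<mu>) = (\<integral>\<^sup>+t. u ((doubling ^^ k) t) \<partial>distr \<mu> borel doubling)"
    by (simp only: invariant_measuresD(3)[OF assms(1)])
  also have "\<dots> = (\<integral>\<^sup>+t. u ((doubling ^^ k) (doubling t)) \<partial>\<mu>)"
    by (subst nn_integral_distr) measurable
  finally show ?case using Suc by (simp add: funpow_swap1)
qed simp

lemma ereal_integral_potential_le:
  assumes \<mu>: "\<mu> \<in> invariant_measures" and "0 < n" "0 < B" and bound: "\<And>x. cos_prod c n x \<le> B"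
  shows "ereal_integral \<mu> (potential c) \<le> ereal (ln B / real n)"
proof -
  interpret prob_space \<mu> using invariant_measuresD(1)[OF \<mu>] .
  note [measurable_cong] = invariant_measuresD(2)[OF \<mu>]
  have [measurable]: "(doubling ^^ k) \<in> borel \<rightarrow>\<^sub>M borel" for k
    by (induction k) (simp_all add: measurable_doubling measurable_comp)
  define I where "I = (\<integral>\<^sup>+t. e2ennreal (- potential c t) \<partial>\<mu>)"
  have "ennreal (- ln B) \<le> (\<Sum>k<n. e2ennreal (- potential c ((doubling ^^ k) t)))" for t
  proof -
    obtain x where t: "t = abs_torus x" by (metis Quotient_abs_rep Quotient_torus)
    have "0 < cos_prod c n x \<Longrightarrow> - ln B \<le> - ln (cos_prod c n x)"
      using bound[of x] by simp
    then show ?thesis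
      using cos_prod_nonneg[of c n x]
      by (auto simp: t funpow_doubling sum_potential_orbit order_less_le intro: ennreal_leI)
  qed
  then have "(\<integral>\<^sup>+t. ennreal (- ln B) \<partial>\<mu>) \<le> (\<integral>\<^sup>+t. (\<Sum>k<n. e2ennreal (- potential c ((doubling ^^ k) t))) \<partial>\<mu>)"
    by (intro nn_integral_mono)
  also have "\<dots> = (\<Sum>k<n. \<integral>\<^sup>+t. e2ennreal (- potential c ((doubling ^^ k) t)) \<partial>\<mu>)"
    by (rule nn_integral_sum) measurable
  also have "\<dots> = (\<Sum>k<n. I)"
    unfolding I_def
    by (intro sum.cong refl nn_integral_funpow_doubling[OF \<mu>, where u = "\<lambda>t. e2ennreal (- potential c t)"]) measurable
  finally have *: "ennreal (- ln B) \<le> of_nat n * I"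
    by (simp add: emeasure_space_1)
  show ?thesis
  proof (cases I rule: ennreal_cases)
    case (real r)
    have "ennreal (- ln B) \<le> ennreal (real n * r)"
      using * real by (simp add: ennreal_mult ennreal_of_nat_eq_real_of_nat)
    \<comment> \<open>For \<open>B > 1\<close> the left side had been truncated to 0; the real
      inequality still holds because \<open>real n * r\<close> is nonnegative.\<close>
    then have "- ln B \<le> real n * r"
      using real by (simp add: ennreal_le_iff)
    then show ?thesis
      using real \<open>0 < n\<close> unfolding ereal_integral_potential I_def[symmetric]
      by (simp add: enn2ereal_ennreal field_simps)
  next
    case top
    then show ?thesis
      unfolding ereal_integral_potential I_def[symmetric] by simp
  qed
qed

section \<open>Uniform measures on periodic orbits\<close>

lemma abs_torus_orbit_mod:
  assumes "(2 ^ p - 1) * y \<in> \<int>"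
  shows "abs_torus (2 ^ (i mod p) * y) = abs_torus (2 ^ i * y)"
proof -
  have "abs_torus (2 ^ (j + p * q) * y) = abs_torus (2 ^ j * y)" for j q
  proof (induction q)
    case (Suc q)
    have "2 ^ (j + p * q) * ((2 ^ p - 1) * y) \<in> \<int>"
      by (rule Ints_mult[OF _ assms]) simp
    also have "2 ^ (j + p * q) * ((2 ^ p - 1) * y) = 2 ^ (j + p * Suc q) * y - 2 ^ (j + p * q) * y"
      by (simp add: power_add algebra_simps)
    finally have "abs_torus (2 ^ (j + p * Suc q) * y) = abs_torus (2 ^ (j + p * q) * y)"
      by (simp only: abs_torus_eq_iff)
    with Suc show ?case by simp
  qed simp
  from this[of "i mod p" "i div p"] show ?thesis by simp
qed

text \<open>The uniform law sits on the indices and not on the set of orbit points, so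
  \<open>p\<close> may be any period, minimal or not.\<close>

definition orbit_measure :: "nat \<Rightarrow> real \<Rightarrow> torus measure" where
  "orbit_measure p y = distr (measure_pmf (pmf_of_set {..<p})) borel (\<lambda>i. abs_torus (2 ^ i * y))"

text \<open>Doubling acts on the indices as the cyclic shift modulo \<open>p\<close>, a bijection
  that preserves the uniform law.\<close>

lemma orbit_measure_invariant:
  assumes "0 < p" "(2 ^ p - 1) * y \<in> \<int>"
  shows "orbit_measure p y \<in> invariant_measures"
proof -
  have "inj_on (\<lambda>i. Suc i mod p) {..<p}"
    by (auto simp: inj_on_def mod_Suc split: if_splits)
  moreover have "(\<lambda>i. Suc i mod p) ` {..<p} \<subseteq> {..<p}" using assms by auto
  ultimately have "bij_betw (\<lambda>i. Suc i mod p) {..<p} {..<p}"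
    by (simp add: bij_betw_def endo_inj_surj)
  then have "map_pmf (\<lambda>i. Suc i mod p) (pmf_of_set {..<p}) = pmf_of_set {..<p}"
    using assms by (intro map_pmf_of_set_bij_betw) auto
  then have rotate: "distr (measure_pmf (pmf_of_set {..<p})) (count_space UNIV) (\<lambda>i. Suc i mod p)
      = measure_pmf (pmf_of_set {..<p})"
    by (metis map_pmf_rep_eq)
  have "distr (orbit_measure p y) borel doubling
      = distr (measure_pmf (pmf_of_set {..<p})) borel (doubling \<circ> (\<lambda>i. abs_torus (2 ^ i * y)))"
    unfolding orbit_measure_def by (rule distr_distr) auto
  also have "doubling \<circ> (\<lambda>i. abs_torus (2 ^ i * y)) = (\<lambda>i. abs_torus (2 ^ i * y)) \<circ> (\<lambda>i. Suc i mod p)"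
    using assms by (auto simp: fun_eq_iff doubling.abs_eq abs_torus_orbit_mod mult.assoc)
  also have "distr (measure_pmf (pmf_of_set {..<p})) borel \<dots> =
      distr (distr (measure_pmf (pmf_of_set {..<p})) (count_space UNIV) (\<lambda>i. Suc i mod p)) borel
        (\<lambda>i. abs_torus (2 ^ i * y))"
    by (rule distr_distr[symmetric]) auto
  also have "\<dots> = orbit_measure p y" unfolding rotate orbit_measure_def ..
  finally show ?thesis
    by (auto simp: invariant_measures_def orbit_measure_def intro: measure_pmf.prob_space_distr)
qed

lemma ereal_integral_orbit_measure:
  assumes "0 < p" "cos_prod c p y \<noteq> 0"
  shows "ereal_integral (orbit_measure p y) (potential c) = ereal (ln (cos_prod c p y) / real p)"
proof -
  have pos: "0 < cos_prod c p y" using assms cos_prod_nonneg[of c p y] by linarith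
  then have "ln (cos_prod c p y) \<le> 0" by (simp add: ln_le_zero_iff)
  have "(\<integral>\<^sup>+t. e2ennreal (- potential c t) \<partial>orbit_measure p y)
      = (\<integral>\<^sup>+i. e2ennreal (- potential c (abs_torus (2 ^ i * y))) \<partial>measure_pmf (pmf_of_set {..<p}))"
    unfolding orbit_measure_def by (subst nn_integral_distr) auto
  also have "\<dots> = (\<Sum>i<p. e2ennreal (- potential c (abs_torus (2 ^ i * y)))) / of_nat p"
    using assms by (subst nn_integral_pmf_of_set) auto
  also have "\<dots> = ennreal (- ln (cos_prod c p y)) / ennreal (real p)"
    using assms by (simp add: sum_potential_orbit ennreal_of_nat_eq_real_of_nat)
  also have "\<dots> = ennreal (- ln (cos_prod c p y) / real p)"
    using assms \<open>ln (cos_prod c p y) \<le> 0\<close> by (intro divide_ennreal) auto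
  finally show ?thesis
    using \<open>ln (cos_prod c p y) \<le> 0\<close>
    by (simp add: ereal_integral_potential enn2ereal_ennreal divide_nonpos_nonneg)
qed

lemma ergodic_supremum_le:
  assumes "0 < n" "0 < B" "\<And>x. cos_prod c n x \<le> B"
  shows "ergodic_supremum c \<le> ereal (ln B / real n)"
  unfolding ergodic_supremum_def by (intro SUP_least ereal_integral_potential_le assms)

lemma ergodic_supremum_ge:
  assumes "0 < p" "(2 ^ p - 1) * y \<in> \<int>" "cos_prod c p y \<noteq> 0"
  shows "ereal (ln (cos_prod c p y) / real p) \<le> ergodic_supremum c"
  unfolding ergodic_supremum_def ereal_integral_orbit_measure[OF assms(1,3), symmetric]
  by (intro SUP_upper orbit_measure_invariant assms)

section \<open>Growth of the cosine product\<close>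

lemma one_minus_half_square_le_cos: "1 - x\<^sup>2 / 2 \<le> cos x" for x :: real
proof -
  have "cos x = 1 - 2 * (sin (x / 2))\<^sup>2"
    using cos_double_sin[of "x / 2"] by simp
  moreover have "(sin (x / 2))\<^sup>2 \<le> (x / 2)\<^sup>2"
    using abs_sin_x_le_abs_x[of "x / 2"] by (simp only: abs_le_square_iff)
  ultimately show ?thesis by (simp add: power2_eq_square)
qed

text \<open>The quadratic bound for cosine with pi^2 \<le> 10: a purely rational estimate near
  integers, fit for numerical checks.\<close>

lemma abs_cos_pi_ge:
  assumes "z - of_int i \<in> {- d..d}"
  shows "1 - 5 * d\<^sup>2 \<le> \<bar>cos (pi * z)\<bar>"
proof -
  have "\<bar>cos (pi * z)\<bar> = \<bar>cos (pi * (z - of_int i))\<bar>"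
    using abs_cos_pi_cong[of z "z - of_int i" 0] by (simp add: cong_mod_one_def)
  moreover have "1 - (pi * (z - of_int i))\<^sup>2 / 2 \<le> cos (pi * (z - of_int i))"
    by (rule one_minus_half_square_le_cos)
  moreover have "(pi * (z - of_int i))\<^sup>2 \<le> 10 * d\<^sup>2"
  proof -
    have "pi\<^sup>2 \<le> 3.15\<^sup>2" using pi_approx by (intro power_mono) auto
    then have "pi\<^sup>2 \<le> 10" by (simp add: power2_eq_square)
    moreover have "(z - of_int i)\<^sup>2 \<le> d\<^sup>2"
      by (rule abs_le_square_iff[THEN iffD1]) (use assms in auto)
    ultimately show ?thesis unfolding power_mult_distrib by (intro mult_mono) auto
  qed
  ultimately show ?thesis by linarith
qed

text \<open>Reflection preserves periods, so cycles found for \<open>c \<le> 1 / 2\<close> also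
  serve \<open>1 - c\<close>.\<close>

lemma cos_prod_minus: "cos_prod (1 - c) n (- y) = cos_prod c n y"
  unfolding cos_prod_def
proof (rule prod.cong)
  fix k
  have "cos (pi * (2 ^ k * - y + (1 - c))) = cos (pi - pi * (2 ^ k * y + c))"
    by (simp add: algebra_simps)
  then show "\<bar>cos (pi * (2 ^ k * - y + (1 - c)))\<bar> = \<bar>cos (pi * (2 ^ k * y + c))\<bar>" by simp
qed simp

text \<open>The fixed point \<open>0\<close> and the cycles of \<open>3 / 7\<close> and \<open>1 / 3\<close> serve \<open>c < 1 / 4\<close>,
  \<open>c \<in> {1 / 4..7 / 20}\<close> and \<open>c \<in> {7 / 20..1 / 2}\<close>.\<close>

lemma periodic_point_large_half:
  assumes "0 < c" "c \<le> 1 / 2"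
  shows "\<exists>p y. 0 < p \<and> (2 ^ p - 1) * y \<in> \<int> \<and> (1 / 2) ^ p < (cos_prod c p y)\<^sup>2"
proof -
  consider "c < 1 / 4" | "1 / 4 \<le> c" "c \<le> 7 / 20" | "7 / 20 < c" by linarith
  then show ?thesis
  proof cases
    case 1
    have "cos (pi / 4) < cos (pi * c)"
      using assms 1 by (intro cos_monotone_0_pi) auto
    then have "(sqrt 2 / 2)\<^sup>2 < (cos (pi * c))\<^sup>2"
      by (intro power_strict_mono) (simp_all add: cos_45)
    then have "(1 / 2) ^ 1 < (cos_prod c 1 0)\<^sup>2"
      by (simp add: cos_prod_def power_divide)
    moreover have "(2 ^ 1 - 1) * 0 \<in> (\<int> :: real set)" by simp
    ultimately show ?thesis by (intro exI[of _ 1] exI[of _ 0] conjI) simp_all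
  next
    case 2
    \<comment> \<open>0.3215, 0.2075 and 0.065 bound the distances of the three arguments from the
      integers 1, 1 and 2 over this range of \<open>c\<close>. The squared product of the bounds is
      about 0.137, against the required 1/8.\<close>
    have "1 - 5 * 0.3215\<^sup>2 \<le> \<bar>cos (pi * (3 / 7 + c))\<bar>"
      by (rule abs_cos_pi_ge[of _ 1]) (use 2 in simp)
    moreover have "1 - 5 * 0.2075\<^sup>2 \<le> \<bar>cos (pi * (6 / 7 + c))\<bar>"
      by (rule abs_cos_pi_ge[of _ 1]) (use 2 in simp)
    moreover have "1 - 5 * 0.065\<^sup>2 \<le> \<bar>cos (pi * (12 / 7 + c))\<bar>"
      by (rule abs_cos_pi_ge[of _ 2]) (use 2 in simp)
    ultimately have "0.483 * 0.784 * 0.978 \<le>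
        \<bar>cos (pi * (3 / 7 + c))\<bar> * \<bar>cos (pi * (6 / 7 + c))\<bar> * \<bar>cos (pi * (12 / 7 + c))\<bar>"
      by (intro mult_mono) (simp_all add: power2_eq_square)
    also have "\<dots> = cos_prod c 3 (3 / 7)"
      by (simp add: cos_prod_def numeral_3_eq_3)
    finally have "(0.483 * 0.784 * 0.978)\<^sup>2 \<le> (cos_prod c 3 (3 / 7))\<^sup>2"
      by (intro power_mono) simp_all
    then have "(1 / 2) ^ 3 < (cos_prod c 3 (3 / 7))\<^sup>2"
      by (simp add: power2_eq_square power3_eq_cube)
    moreover have "(2 ^ 3 - 1) * (3 / 7) \<in> (\<int> :: real set)" by simp
    ultimately show ?thesis by (intro exI[of _ 3] exI[of _ "3 / 7"] conjI) simp_all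
  next
    case 3
    \<comment> \<open>The cycle of 1/3 beats the threshold exactly for \<open>c > 1 / 3\<close> and
      the fixed point 0 exactly for \<open>c < 1 / 4\<close>; the 3-cycle bridges the gap.\<close>
    have "cos (2 * pi * c) < cos (2 * pi / 3)"
      using assms 3 by (intro cos_monotone_0_pi) (auto simp: field_simps)
    then have "1 / 2 < (1 / 2 - cos (2 * pi * c)) / 2" by (simp add: cos_120)
    also have "\<dots> = cos (pi * (1 / 3 + c)) * cos (pi * (2 / 3 + c))"
    proof -
      have "pi * (1 / 3 + c) - pi * (2 / 3 + c) = - (pi / 3)"
        "pi * (1 / 3 + c) + pi * (2 / 3 + c) = 2 * pi * c + pi"
        by (simp_all add: field_simps)
      then show ?thesis by (simp only: cos_times_cos cos_minus cos_60 cos_periodic_pi) simp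
    qed
    also have "\<dots> \<le> \<bar>\<dots>\<bar>" by (rule abs_ge_self)
    also have "\<dots> = cos_prod c 2 (1 / 3)" by (simp add: cos_prod_2 abs_mult)
    finally have "(1 / 2)\<^sup>2 < (cos_prod c 2 (1 / 3))\<^sup>2"
      by (intro power_strict_mono) simp_all
    moreover have "(2 ^ 2 - 1) * (1 / 3) \<in> (\<int> :: real set)" by simp
    ultimately show ?thesis by (intro exI[of _ 2] exI[of _ "1 / 3"] conjI) simp_all
  qed
qed

lemma periodic_point_large:
  assumes "0 < c" "c < 1"
  obtains p y where "0 < p" "(2 ^ p - 1) * y \<in> \<int>" "(1 / 2) ^ p < (cos_prod c p y)\<^sup>2"
proof (cases "c \<le> 1 / 2")
  case True
  then show thesis using periodic_point_large_half[OF assms(1)] that by blast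
next
  case False
  then obtain p y where "0 < p" "(2 ^ p - 1) * y \<in> \<int>" "(1 / 2) ^ p < (cos_prod (1 - c) p y)\<^sup>2"
    using periodic_point_large_half[of "1 - c"] assms by auto
  moreover from this have "(2 ^ p - 1) * - y \<in> \<int>" by simp
  ultimately show thesis
    using cos_prod_minus[of "1 - c" p y] by (intro that[of p "- y"]) simp_all
qed

text \<open>\<open>- ln 2 / 2\<close> is the value of beta for which the exponent equals 1/2. For a
  cycle, exceeding it means \<open>(1 / 2) ^ p < (cos_prod c p y)^2\<close>, a form free of roots
  and logarithms.\<close>

lemma ergodic_supremum_gt:
  assumes "0 < c" "c < 1"
  shows "ereal (- ln 2 / 2) < ergodic_supremum c"
proof -
  obtain p y where py: "0 < p" "(2 ^ p - 1) * y \<in> \<int>" "(1 / 2) ^ p < (cos_prod c p y)\<^sup>2"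
    by (rule periodic_point_large[OF assms])
  have "0 < (cos_prod c p y)\<^sup>2" using py(3) by (rule less_trans[rotated]) simp
  then have "cos_prod c p y \<noteq> 0" by auto
  then have "0 < cos_prod c p y" using cos_prod_nonneg[of c p y] by linarith
  have "ln ((1 / 2) ^ p) < ln ((cos_prod c p y)\<^sup>2)"
    using py(3) \<open>0 < cos_prod c p y\<close> by (subst ln_less_cancel_iff) simp_all
  then have "- (real p * ln 2) < 2 * ln (cos_prod c p y)"
    using \<open>0 < cos_prod c p y\<close> by (simp add: ln_realpow ln_div)
  then have "- ln 2 / 2 < ln (cos_prod c p y) / real p"
    using py(1) by (simp add: field_simps)
  then have "ereal (- ln 2 / 2) < ereal (ln (cos_prod c p y) / real p)" by simp
  also have "\<dots> \<le> ergodic_supremum c"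
    using py \<open>cos_prod c p y \<noteq> 0\<close> by (intro ergodic_supremum_ge)
  finally show ?thesis .
qed

section \<open>Exponent below 1\<close>

lemma abs_cos_pi_eq_1D:
  assumes "\<bar>cos (pi * z)\<bar> = 1"
  shows "z \<in> \<int>"
proof -
  have "(cos (pi * z))\<^sup>2 = 1" using assms by (metis power2_abs one_power2)
  then have "sin (pi * z) = 0" using sin_cos_squared_add[of "pi * z"] by simp
  then obtain i :: int where "pi * z = of_int i * pi" unfolding sin_zero_iff_int2 by blast
  then have "z = of_int i" by simp
  then show ?thesis by simp
qed

text \<open>If both factors had modulus 1 at \<open>x0\<close>, then \<open>x0 + c\<close> and
  \<open>2 * x0 + c\<close> would be integers, and so would
  \<open>c = 2 * (x0 + c) - (2 * x0 + c)\<close>. Hence the maximum over two steps is already below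
  1.\<close>

lemma ergodic_supremum_neg:
  assumes "0 < c" "c < 1"
  shows "ergodic_supremum c < 0"
proof -
  obtain x0 where x0: "\<And>x. cos_prod c 2 x \<le> cos_prod c 2 x0"
    using cos_prod_attains_max by blast
  have "cos_prod c 2 x0 \<noteq> 1"
  proof
    assume 1: "cos_prod c 2 x0 = 1"
    let ?a = "\<bar>cos (pi * (x0 + c))\<bar>" and ?b = "\<bar>cos (pi * (2 * x0 + c))\<bar>"
    have "?a * ?b \<le> ?a * 1" "?a * ?b \<le> 1 * ?b" by (intro mult_mono; simp)+
    moreover have "?a * ?b = 1" using 1 by (simp only: cos_prod_2)
    moreover have "?a \<le> 1" "?b \<le> 1" by simp_all
    ultimately have "?a = 1" "?b = 1" by linarith+
    then have "2 * (x0 + c) - (2 * x0 + c) \<in> \<int>"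
      by (intro Ints_diff Ints_mult abs_cos_pi_eq_1D) simp_all
    then obtain i :: int where "c = of_int i" by (auto elim: Ints_cases)
    with assms have "0 < i" "i < 1" by simp_all
    then show False by simp
  qed
  \<comment> \<open>The 1/2 only guarantees a positive argument for the logarithm.\<close>
  define B where "B = max (1 / 2) (cos_prod c 2 x0)"
  have "0 < B" "B < 1"
    using \<open>cos_prod c 2 x0 \<noteq> 1\<close> cos_prod_le_1[of c 2 x0] unfolding B_def
    by (auto simp: order_less_le simp del: cos_prod_le_1)
  have "ergodic_supremum c \<le> ereal (ln B / real 2)"
    using \<open>0 < B\<close> x0 by (intro ergodic_supremum_le) (simp_all add: B_def max.coboundedI2)
  also have "\<dots> < 0" using \<open>0 < B\<close> \<open>B < 1\<close> by simp
  finally show ?thesis .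
qed

lemma cos_prod_growth:
  assumes "0 < c" "c < 1"
  obtains b C where "ergodic_supremum c = ereal b" "- ln 2 / 2 < b" "b < 0" "0 < C"
    "\<And>n x. cos_prod c n x \<le> C * exp b ^ n"
    "\<And>n. \<exists>x\<in>{0..1}. exp b ^ n \<le> cos_prod c n x"
proof -
  obtain b where b: "ergodic_supremum c = ereal b"
    using ergodic_supremum_gt[OF assms] ergodic_supremum_neg[OF assms]
    by (cases "ergodic_supremum c") auto
  have "- ln 2 / 2 < b" "b < 0"
    using ergodic_supremum_gt[OF assms] ergodic_supremum_neg[OF assms] unfolding b by simp_all
  obtain C n0 where C: "0 < C" and near:
    "\<And>n. n0 \<le> n \<Longrightarrow> \<exists>y. (2 ^ (n + 2) - 1) * y \<in> \<int> \<and> (\<forall>x. cos_prod c n x \<le> C * cos_prod c (n + 2) y)"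
    using periodic_point_near_max[OF assms] by blast
  have periodic: "cos_prod c p y \<le> exp b ^ p" if "0 < p" "(2 ^ p - 1) * y \<in> \<int>" for p y
  proof (cases "cos_prod c p y = 0")
    case False
    then have pos: "0 < cos_prod c p y" using cos_prod_nonneg[of c p y] by linarith
    have "ln (cos_prod c p y) / real p \<le> b"
      using ergodic_supremum_ge[OF that False] unfolding b by simp
    then have "ln (cos_prod c p y) \<le> real p * b" using that(1) by (simp add: field_simps)
    then have "exp (ln (cos_prod c p y)) \<le> exp (real p * b)" by simp
    then show ?thesis using pos by (simp add: exp_of_nat_mult)
  qed simp
  \<comment> \<open>The second term covers the finitely many \<open>n < n0\<close> by the trivial
    bound 1.\<close>
  define C' where "C' = max C (1 / exp b ^ n0)"
  have "cos_prod c n x \<le> C' * exp b ^ n" for n x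
  proof (cases "n0 \<le> n")
    case True
    then obtain y where y: "(2 ^ (n + 2) - 1) * y \<in> \<int>" "cos_prod c n x \<le> C * cos_prod c (n + 2) y"
      using near by blast
    note y(2)
    also have "C * cos_prod c (n + 2) y \<le> C * exp b ^ (n + 2)"
      using y(1) C by (intro mult_left_mono periodic) simp_all
    also have "\<dots> \<le> C' * exp b ^ n"
      using C \<open>b < 0\<close> by (intro mult_mono power_decreasing) (auto simp: C'_def)
    finally show ?thesis .
  next
    case False
    have "exp b ^ n0 \<le> exp b ^ n"
      using False \<open>b < 0\<close> by (intro power_decreasing) auto
    then have "1 \<le> 1 / exp b ^ n0 * exp b ^ n" by simp
    also have "\<dots> \<le> C' * exp b ^ n"
      by (intro mult_right_mono) (auto simp: C'_def)
    finally show ?thesis using cos_prod_le_1[of c n x] by linarith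
  qed
  moreover have "\<exists>x\<in>{0..1}. exp b ^ n \<le> cos_prod c n x" for n
  proof (cases "n = 0")
    case True
    then show ?thesis by (auto simp: cos_prod_def)
  next
    case False
    obtain x0 where x0: "x0 \<in> {0..1}" "\<And>x. cos_prod c n x \<le> cos_prod c n x0"
      by (rule cos_prod_attains_max[of c n]) blast
    have "exp b ^ n \<le> cos_prod c n x0"
    proof (rule ccontr)
      assume "\<not> ?thesis"
      \<comment> \<open>An intermediate \<open>B\<close> is positive even if the maximum were 0, so
        its logarithm is meaningful.\<close>
      then obtain B where B: "cos_prod c n x0 < B" "B < exp b ^ n"
        using dense[of "cos_prod c n x0" "exp b ^ n"] by auto
      then have "0 < B" using cos_prod_nonneg[of c n x0] by linarith
      have "cos_prod c n x \<le> B" for x using x0(2)[of x] B(1) by linarith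
      then have "b \<le> ln B / real n"
        using ergodic_supremum_le[of n B c] False \<open>0 < B\<close> unfolding b by simp
      then have "real n * b \<le> ln B" using False by (simp add: field_simps)
      moreover have "ln B < ln (exp b ^ n)" using B(2) \<open>0 < B\<close> by (subst ln_less_cancel_iff) simp_all
      ultimately show False by (simp add: ln_realpow)
    qed
    with x0(1) show ?thesis by blast
  qed
  moreover have "0 < C'" using C by (simp add: C'_def)
  ultimately show thesis using that b \<open>- ln 2 / 2 < b\<close> \<open>b < 0\<close> by blast
qed

section \<open>The Gelfond exponent\<close>

lemma bdd_above_thue_morse_sum: "bdd_above ((\<lambda>t. cmod (thue_morse_sum c N t)) ` A)"
proof (rule bdd_aboveI2)
  fix t
  have "cmod (thue_morse_sum c N t) \<le> (\<Sum>n<N. cmod (thue_morse c n * cis (2 * pi * real n * t)))"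
    unfolding thue_morse_sum_def by (rule norm_sum)
  also have "\<dots> = real N" by (simp add: norm_mult thue_morse_def)
  finally show "cmod (thue_morse_sum c N t) \<le> real N" .
qed

lemma thue_morse_sup_norm_eq:
  "thue_morse_sup_norm c N = (SUP t\<in>{0..1}. cmod (thue_morse_sum c N t))"
  by (simp add: thue_morse_sup_norm_def thue_morse_sum_def)

lemma thue_morse_sup_norm_ge:
  "t \<in> {0..1} \<Longrightarrow> cmod (thue_morse_sum c N t) \<le> thue_morse_sup_norm c N"
  unfolding thue_morse_sup_norm_eq by (rule cSUP_upper[OF _ bdd_above_thue_morse_sum])

lemma thue_morse_sup_norm_le:
  "(\<And>t. cmod (thue_morse_sum c N t) \<le> B) \<Longrightarrow> thue_morse_sup_norm c N \<le> B"
  unfolding thue_morse_sup_norm_eq by (rule cSUP_least) auto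

lemma thue_morse_sup_norm_nonneg: "0 \<le> thue_morse_sup_norm c N"
  by (rule order_trans[OF norm_ge_zero thue_morse_sup_norm_ge[of 0]]) simp

lemma norm_thue_morse_sum_le_dyadic:
  assumes bound: "\<And>i t. cmod (thue_morse_sum c (2 ^ i) t) \<le> B i" and "N < 2 ^ k"
  shows "cmod (thue_morse_sum c N t) \<le> (\<Sum>i<k. B i)"
  using assms(2)
proof (induction k arbitrary: N)
  case 0
  then show ?case by (simp add: thue_morse_sum_def)
next
  case (Suc k)
  show ?case
  proof (cases "N < 2 ^ k")
    case True
    \<comment> \<open>A zero digit of \<open>N\<close> contributes no block, but its term may be
      added since it is nonnegative.\<close>
    have "0 \<le> B k" using bound[of k 0] norm_ge_zero order_trans by blast
    with Suc.IH[OF True] show ?thesis by simp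
  next
    case False
    define M where "M = N - 2 ^ k"
    have N: "N = 2 ^ k + M" "M < 2 ^ k" using False Suc.prems by (auto simp: M_def)
    have "thue_morse_sum c N t =
        thue_morse_sum c (2 ^ k) t + cis (2 * pi * (2 ^ k * t + c)) * thue_morse_sum c M t"
      unfolding N(1) by (rule thue_morse_sum_add_power) (use N(2) in simp)
    also have "cmod \<dots> \<le> cmod (thue_morse_sum c (2 ^ k) t) + cmod (thue_morse_sum c M t)"
      using norm_triangle_ineq[of "thue_morse_sum c (2 ^ k) t" "cis (2 * pi * (2 ^ k * t + c)) * thue_morse_sum c M t"]
      by (simp add: norm_mult)
    also have "\<dots> \<le> B k + (\<Sum>i<k. B i)"
      by (intro add_mono bound Suc.IH N)
    finally show ?thesis by simp
  qed
qed

lemma powr_power_swap: "(2 ^ n) powr a = (2 powr a) ^ n" for a :: real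
  by (simp add: powr_powr powr_realpow[symmetric] mult.commute)

theorem theorem2p3:
  fixes c :: real
  assumes "0 < c" and "c < 1"
  shows "\<exists>\<Delta>. is_gelfond_exponent c \<Delta> \<and> ereal \<Delta> = 1 + ergodic_supremum c / ereal (ln 2)"
proof -
  obtain b C where b: "ergodic_supremum c = ereal b" "- ln 2 / 2 < b" "b < 0" and "0 < C"
    and upper: "\<And>n x. cos_prod c n x \<le> C * exp b ^ n"
    and lower: "\<And>n. \<exists>x\<in>{0..1}. exp b ^ n \<le> cos_prod c n x"
    using cos_prod_growth[OF assms] by blast
  define \<Delta> where "\<Delta> = 1 + b / ln 2"
  \<comment> \<open>The growth factor of the norm when the length doubles. As \<open>q > 1\<close>,
    the sum over dyadic blocks is geometric and dominated by its last term, so only a constant is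
    lost.\<close>
  define q where "q = 2 powr \<Delta>"
  have \<Delta>: "1 / 2 < \<Delta>" "\<Delta> < 1"
    using b by (simp_all add: \<Delta>_def field_simps)
  have q: "q = 2 * exp b" by (simp add: q_def \<Delta>_def powr_def distrib_right exp_add)
  have "1 < q" using \<Delta> by (simp add: q_def)
  have dyadic_upper: "cmod (thue_morse_sum c (2 ^ n) t) \<le> C * q ^ n" for n t
    using upper[of n t] by (simp add: norm_thue_morse_sum_power2 q power_mult_distrib mult_ac)
  have dyadic_lower: "q ^ n \<le> thue_morse_sup_norm c (2 ^ n)" for n
  proof -
    obtain x where x: "x \<in> {0..1}" "exp b ^ n \<le> cos_prod c n x" using lower by blast
    have "q ^ n \<le> cmod (thue_morse_sum c (2 ^ n) x)"
      using x(2) by (simp add: norm_thue_morse_sum_power2 q power_mult_distrib)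
    also have "\<dots> \<le> thue_morse_sup_norm c (2 ^ n)" by (rule thue_morse_sup_norm_ge[OF x(1)])
    finally show ?thesis .
  qed
  have bound: "thue_morse_sup_norm c N \<le> C * q / (q - 1) * real N powr \<Delta>" if "1 \<le> N" for N
  proof -
    obtain k where k: "2 ^ k \<le> N" "N < 2 ^ (k + 1)" using ex_power_ivl1[of 2 N] \<open>1 \<le> N\<close> by auto
    have "real (2 ^ k) \<le> real N" using k(1) by (simp only: of_nat_le_iff)
    then have "(2 ^ k) powr \<Delta> \<le> real N powr \<Delta>" using \<Delta> by (intro powr_mono2) auto
    then have qk: "q ^ k \<le> real N powr \<Delta>" by (simp add: powr_power_swap q_def)
    have "thue_morse_sup_norm c N \<le> (\<Sum>i<k+1. C * q ^ i)"
      by (intro thue_morse_sup_norm_le norm_thue_morse_sum_le_dyadic dyadic_upper k)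
    also have "\<dots> = C * ((q ^ (k + 1) - 1) / (q - 1))"
      using \<open>1 < q\<close> by (subst sum_distrib_left[symmetric], subst geometric_sum) auto
    also have "\<dots> \<le> C * (q * real N powr \<Delta> / (q - 1))"
    proof (intro mult_left_mono divide_right_mono)
      have "q ^ (k + 1) \<le> q * real N powr \<Delta>" using qk \<open>1 < q\<close> by simp
      then show "q ^ (k + 1) - 1 \<le> q * real N powr \<Delta>" by linarith
    qed (use \<open>0 < C\<close> \<open>1 < q\<close> in auto)
    finally show ?thesis by simp
  qed
  have "(\<lambda>N. thue_morse_sup_norm c N) \<in> O(\<lambda>N. real N powr \<Delta>)"
  proof (rule bigoI)
    show "\<forall>\<^sub>F N in sequentially. norm (thue_morse_sup_norm c N) \<le> C * q / (q - 1) * norm (real N powr \<Delta>)"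
      using eventually_ge_at_top[of 1] by eventually_elim (use bound in \<open>simp add: thue_morse_sup_norm_nonneg\<close>)
  qed
  moreover have "\<Delta> \<le> \<alpha>" if "gelfond_bound c \<alpha>" for \<alpha>
  proof (rule ccontr)
    assume "\<not> \<Delta> \<le> \<alpha>"
    \<comment> \<open>Along \<open>N = 2 ^ n\<close> the norm exceeds \<open>N powr \<alpha>\<close>
      by at least \<rho>^n, which is unbounded if \<alpha> < \<Delta>.\<close>
    define \<rho> where "\<rho> = 2 powr (\<Delta> - \<alpha>)"
    have "1 < \<rho>" using \<open>\<not> \<Delta> \<le> \<alpha>\<close> by (simp add: \<rho>_def)
    have "(\<lambda>N. thue_morse_sup_norm c N) \<in> O(\<lambda>N. real N powr \<alpha>)"
      using that by (simp add: gelfond_bound_def)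
    then obtain K where "\<forall>\<^sub>F N in sequentially. norm (thue_morse_sup_norm c N) \<le> K * norm (real N powr \<alpha>)"
      by (elim landau_o.bigE)
    then obtain N0 where N0: "\<And>N. N0 \<le> N \<Longrightarrow> thue_morse_sup_norm c N \<le> K * real N powr \<alpha>"
      by (auto simp: eventually_at_top_linorder thue_morse_sup_norm_nonneg)
    obtain n1 where "K < \<rho> ^ n1" using real_arch_pow[OF \<open>1 < \<rho>\<close>] by blast
    define n where "n = max N0 n1"
    have "\<rho> ^ n1 \<le> \<rho> ^ n" using \<open>1 < \<rho>\<close> by (intro power_increasing) (auto simp: n_def)
    have "N0 \<le> n" by (simp add: n_def)
    then have "N0 \<le> 2 ^ n" using less_exp[of n] by linarith
    then have "q ^ n \<le> K * real (2 ^ n) powr \<alpha>"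
      using N0[of "2 ^ n"] dyadic_lower[of n] by linarith
    then have "q ^ n \<le> K * (2 powr \<alpha>) ^ n" by (simp add: powr_power_swap)
    moreover have "q ^ n = \<rho> ^ n * (2 powr \<alpha>) ^ n"
      by (simp add: q_def \<rho>_def flip: power_mult_distrib powr_add)
    ultimately have "\<rho> ^ n \<le> K" by simp
    with \<open>K < \<rho> ^ n1\<close> \<open>\<rho> ^ n1 \<le> \<rho> ^ n\<close> show False by linarith
  qed
  ultimately have "is_gelfond_exponent c \<Delta>"
    using \<Delta> by (simp add: is_gelfond_exponent_def gelfond_bound_def)
  moreover have "ereal \<Delta> = 1 + ergodic_supremum c / ereal (ln 2)"
    by (simp add: \<Delta>_def b one_ereal_def)
  ultimately show ?thesis by blast
qed

end
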